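(* Assume that $K$ is injective, that $\hat y\in\mathcal{D}(K^+)$, and that $(\delta_m^{disc})$, $(c_m)$, $(C_m)$ are sequences of positive numbers such that, for all $m$ large enough, $\|\hat y-P_m^+P_m\hat y\|\le\delta_m^{disc}$ and $0<c_m\le\sigma_j^{(m)}\le C_m$ for $j=1,\dots,m$, and such that $\delta_m^{disc}\to0$ as $m\to\infty$ and $\limsup_{m\to\infty}C_m/c_m<\infty$. Assume that for all $m$ and all $j\le m$ the random variables $(\delta_{ij}^{(m)})_{i\in\mathbb{N}}$ are independent with zero mean and that there is $C_d\in\mathbb{R}$ with $\sup_{m,i,j\in\mathbb{N},\,j\le m}\mathbb{E}[(\delta_{ij}^{(m)})^2]\le C_d$. Let $(F_\alpha)_{\alpha>0}$ be a regularising filter as defined in the context, and let $\alpha:(0,\infty)\to(0,\infty)$ be an a priori parameter choice rule with $\alpha(\delta)\to0$ and $\delta/\sqrt{\alpha(\delta)}\to0$ as $\delta\to0$. Then, with $n(m,\delta_m^{disc})=\left\lceil\frac{m}{c_m^2(\delta_m^{disc})^2}\right\rceil$, $$\lim_{m\to\infty}\mathbb{E}\left\|R_{\alpha(\delta_m^{disc})}P_m^+\bar Y^{(m)}_{n(m,\delta_m^{disc})}-K^+\hat y\right\|^2=0 .$$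
   Context: $\mathcal{X},\mathcal{Y}$ are infinite-dimensional real Hilbert spaces, $K:\mathcal{X}\to\mathcal{Y}$ is a compact linear operator, and $K^+$ is its Moore-Penrose inverse with domain $\mathcal{D}(K^+)=\mathcal{R}(K)\oplus\mathcal{R}(K)^\perp$. Discretisation: for each $m\in\mathbb{N}$, $l^{(m)}_1,\dots,l_m^{(m)}$ are continuous linear functionals on $\mathcal{Y}$ with $\|l_1^{(m)}\|=\dots=\|l_m^{(m)}\|$, and $P_m:\mathcal{Y}\to\mathbb{R}^m$, $P_my=(l_1^{(m)}(y),\dots,l_m^{(m)}(y))^T$, with $P_mP_m^*$ bijective. $P_m^+$ is the Moore-Penrose inverse of $P_m$ and $\sigma_1^{(m)},\dots,\sigma_m^{(m)}$ are the singular values of $P_m$. Measurements: $Y^{(m)}_{ij}=l_j^{(m)}(\hat y)+\delta_{ij}^{(m)}$ and $\bar Y_n^{(m)}=\frac1n\sum_{i=1}^n(Y^{(m)}_{i1},\dots,Y^{(m)}_{im})^T$. Filter: $(F_\alpha)_{\alpha>0}$ are piecewise continuous real-valued functions on $[0,\|K\|^2]$ such that: (i) $\lim_{\alpha\to0}\sup_{\varepsilon\le\lambda\le\|K\|^2}|F_\alpha(\lambda)-1/\lambda|=0$ for all $\varepsilon>0$; (ii) there is $C_R\in\mathbb{R}$ with $\lambda|F_\alpha(\lambda)|\le C_R$ for all $\lambda\in(0,\|K\|^2]$, $\alpha>0$; (iii) it has qualification $\nu_0\ge0$, i.e. $\nu_0$ (possibly $\infty$) is maximal such that for all $0\le\nu\le\nu_0$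 (with $\nu<\infty$) there is $C_\nu\in\mathbb{R}$ with $\sup_{\lambda\in(0,\|K\|^2]}\lambda^{\nu/2}|1-F_\alpha(\lambda)\lambda|\le C_\nu\alpha^{\nu/2}$ for all $\alpha>0$; (iv) there is $C_F\in\mathbb{R}$ with $|F_\alpha(\lambda)|\le C_F/\alpha$ for all $\alpha>0$, $\lambda\in(0,\|K\|^2]$. Regularisation: $R_\alpha:=F_\alpha(K^*K)K^*:\mathcal{Y}\to\mathcal{X}$. *)

theory Defs
  imports "HOL-Probability.Probability"
begin

definition compact_operator :: "('a::real_normed_vector \<Rightarrow> 'b::real_normed_vector) \<Rightarrow> bool" where
  "compact_operator T \<longleftrightarrow> linear T \<and> (\<forall>B. bounded B \<longrightarrow> compact (closure (T ` B)))"

text \<open>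
  Moore-Penrose inverse of a linear operator. The value at \<open>y = T x + z\<close>, with \<open>x\<close> orthogonal to
  the null space of \<open>T\<close> and \<open>z\<close> orthogonal to the range of \<open>T\<close>, is \<open>x\<close>; such an \<open>x\<close> exists
  (and is then unique) only for \<open>y\<close> in the domain \<open>mp_domain T\<close>, elsewhere the value is unspecified.
  The inner product \<open>ip\<close> of the codomain is a parameter, so that the definition also applies to
  operators into \<open>\<real>\<^sup>m\<close> with varying \<open>m\<close> (see below). By linearity \<open>{z. T z = T 0}\<close> is the null
  space of \<open>T\<close>.
\<close>

definition mp_inverse ::
    "('b::minus \<Rightarrow> 'b \<Rightarrow> real) \<Rightarrow> ('a::real_inner \<Rightarrow> 'b) \<Rightarrow> 'b \<Rightarrow> 'a" where
  "mp_inverse ip T y =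
     (THE x. x \<in> orthogonal_comp {z. T z = T 0} \<and> (\<forall>z. ip (y - T x) (T z) = 0))"

definition mp_domain :: "('a::real_inner \<Rightarrow> 'b::real_inner) \<Rightarrow> 'b set" where
  "mp_domain T = {a + b | a b. a \<in> range T \<and> b \<in> orthogonal_comp (range T)}"

definition orth_proj :: "'a::real_inner set \<Rightarrow> 'a \<Rightarrow> 'a" where
  "orth_proj S x = (THE p. p \<in> S \<and> x - p \<in> orthogonal_comp S)"

definition eigenspace :: "('a::real_vector \<Rightarrow> 'a) \<Rightarrow> real \<Rightarrow> 'a set" where
  "eigenspace A \<mu> = {v. A v = \<mu> *\<^sub>R v}"

text \<open>
  Functional calculus \<open>f(A)\<close> of a compact self-adjoint operator \<open>A\<close>, whose spectral resolution is
  the sum, over the eigenvalues, of the orthogonal projections onto the eigenspaces.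
\<close>

definition fun_calc :: "(real \<Rightarrow> real) \<Rightarrow> ('a::real_inner \<Rightarrow> 'a) \<Rightarrow> 'a \<Rightarrow> 'a" where
  "fun_calc f A x =
     (\<Sum>\<^sub>\<infinity>\<mu>\<in>{\<mu>. \<exists>v. v \<noteq> 0 \<and> A v = \<mu> *\<^sub>R v}. f \<mu> *\<^sub>R orth_proj (eigenspace A \<mu>) x)"

text \<open>Finitely many exceptional points, at each of which the one-sided limits exist and are finite.\<close>

definition piecewise_continuous :: "real \<Rightarrow> real \<Rightarrow> (real \<Rightarrow> real) \<Rightarrow> bool" where
  "piecewise_continuous a b f \<longleftrightarrow>
     (\<exists>S. finite S \<and> continuous_on ({a..b} - S) f \<and>
        (\<forall>x\<in>S \<inter> {a..b}. (\<exists>L. (f \<longlongrightarrow> L) (at x within {a..<x})) \<and>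
                         (\<exists>L. (f \<longlongrightarrow> L) (at x within {x<..b}))))"

text \<open>
  In the following, \<open>F \<alpha>\<close> is the filter function with parameter \<open>\<alpha> > 0\<close>, on the interval
  \<open>[0, \<Lambda>]\<close>; it is used with \<open>\<Lambda> = \<parallel>K\<parallel>\<^sup>2\<close>.
\<close>

definition filter_order_upto :: "real \<Rightarrow> (real \<Rightarrow> real \<Rightarrow> real) \<Rightarrow> ennreal \<Rightarrow> bool" where
  "filter_order_upto \<Lambda> F \<nu>\<^sub>0 \<longleftrightarrow>
     (\<forall>\<nu>::real. 0 \<le> \<nu> \<and> ennreal \<nu> \<le> \<nu>\<^sub>0 \<longrightarrow>
        (\<exists>C::real. \<forall>\<alpha>>0. \<forall>\<mu>\<in>{0<..\<Lambda>}.
           \<mu> powr (\<nu> / 2) * \<bar>1 - F \<alpha> \<mu> * \<mu>\<bar> \<le> C * \<alpha> powr (\<nu> / 2)))"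

definition has_qualification :: "real \<Rightarrow> (real \<Rightarrow> real \<Rightarrow> real) \<Rightarrow> ennreal \<Rightarrow> bool" where
  "has_qualification \<Lambda> F \<nu>\<^sub>0 \<longleftrightarrow>
     filter_order_upto \<Lambda> F \<nu>\<^sub>0 \<and> (\<forall>\<nu>'. filter_order_upto \<Lambda> F \<nu>' \<longrightarrow> \<nu>' \<le> \<nu>\<^sub>0)"

text \<open>
  The supremum is taken in \<^typ>\<open>ennreal\<close>, where it is \<open>0\<close> over the empty set (the case
  \<open>\<epsilon> > \<Lambda>\<close>) and \<open>\<infinity>\<close> if the function is unbounded.
\<close>

definition regularising_filter :: "real \<Rightarrow> (real \<Rightarrow> real \<Rightarrow> real) \<Rightarrow> ennreal \<Rightarrow> bool" where
  "regularising_filter \<Lambda> F \<nu>\<^sub>0 \<longleftrightarrow>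
     (\<forall>\<alpha>>0. piecewise_continuous 0 \<Lambda> (F \<alpha>)) \<and>
     (\<forall>\<epsilon>>0. ((\<lambda>\<alpha>. SUP \<mu>\<in>{\<epsilon>..\<Lambda>}. ennreal \<bar>F \<alpha> \<mu> - 1 / \<mu>\<bar>) \<longlongrightarrow> 0) (at_right 0)) \<and>
     (\<exists>C\<^sub>R. \<forall>\<alpha>>0. \<forall>\<mu>\<in>{0<..\<Lambda>}. \<mu> * \<bar>F \<alpha> \<mu>\<bar> \<le> C\<^sub>R) \<and>
     has_qualification \<Lambda> F \<nu>\<^sub>0 \<and>
     (\<exists>C\<^sub>F. \<forall>\<alpha>>0. \<forall>\<mu>\<in>{0<..\<Lambda>}. \<bar>F \<alpha> \<mu>\<bar> \<le> C\<^sub>F / \<alpha>)"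

definition reg_op ::
    "('a::real_inner \<Rightarrow> 'b::real_inner) \<Rightarrow> (real \<Rightarrow> real \<Rightarrow> real) \<Rightarrow> real \<Rightarrow> 'b \<Rightarrow> 'a" where
  "reg_op K F \<alpha> y = fun_calc (F \<alpha>) (adjoint K \<circ> K) (adjoint K y)"

text \<open>
  As \<open>m\<close> varies, a vector of \<open>\<real>\<^sup>m\<close> is represented by a function on \<^typ>\<open>nat\<close> that vanishes outside
  the index set \<open>{1..m}\<close>.
\<close>

definition Rvec :: "nat \<Rightarrow> (nat \<Rightarrow> real) set" where
  "Rvec m = {v. \<forall>j. j \<notin> {1..m} \<longrightarrow> v j = 0}"

definition Rinner :: "nat \<Rightarrow> (nat \<Rightarrow> real) \<Rightarrow> (nat \<Rightarrow> real) \<Rightarrow> real" where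
  "Rinner m v w = (\<Sum>j=1..m. v j * w j)"

definition sample_op :: "nat \<Rightarrow> (nat \<Rightarrow> 'b \<Rightarrow> real) \<Rightarrow> 'b \<Rightarrow> (nat \<Rightarrow> real)" where
  "sample_op m l y = (\<lambda>j. if j \<in> {1..m} then l j y else 0)"

text \<open>The Hilbert space adjoint, with respect to \<^const>\<open>Rinner\<close>, of an operator into \<open>\<real>\<^sup>m\<close>.\<close>

definition Radjoint :: "nat \<Rightarrow> ('b::real_inner \<Rightarrow> (nat \<Rightarrow> real)) \<Rightarrow> (nat \<Rightarrow> real) \<Rightarrow> 'b" where
  "Radjoint m P v = (THE y. \<forall>z. Rinner m (P z) v = inner z y)"

text \<open>
  \<open>\<sigma> 1, \<dots>, \<sigma> m\<close> are the (positive) singular values, with multiplicity, of an operator \<open>P\<close> of rank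
  \<open>m\<close> into \<open>\<real>\<^sup>m\<close>, listed in any order: \<open>P\<close> has a singular value decomposition with right singular
  vectors \<open>v j\<close> and left singular vectors \<open>u j\<close>.
\<close>

definition are_singular_values ::
    "nat \<Rightarrow> ('b::real_inner \<Rightarrow> (nat \<Rightarrow> real)) \<Rightarrow> (nat \<Rightarrow> real) \<Rightarrow> bool" where
  "are_singular_values m P \<sigma> \<longleftrightarrow>
     (\<forall>j\<in>{1..m}. \<sigma> j > 0) \<and>
     (\<exists>v u.
        (\<forall>i\<in>{1..m}. \<forall>j\<in>{1..m}. inner (v i) (v j) = (if i = j then 1 else 0)) \<and>
        (\<forall>j\<in>{1..m}. u j \<in> Rvec m) \<and>
        (\<forall>i\<in>{1..m}. \<forall>j\<in>{1..m}. Rinner m (u i) (u j) = (if i = j then 1 else 0)) \<and>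
        (\<forall>y. P y = (\<lambda>k. \<Sum>j=1..m. \<sigma> j * inner y (v j) * u j k)))"

definition mean_meas ::
    "nat \<Rightarrow> (nat \<Rightarrow> 'b \<Rightarrow> real) \<Rightarrow> 'b \<Rightarrow> (nat \<Rightarrow> nat \<Rightarrow> 'w \<Rightarrow> real) \<Rightarrow> nat \<Rightarrow> 'w \<Rightarrow> (nat \<Rightarrow> real)" where
  "mean_meas m l y \<delta> n \<omega> =
     (\<lambda>j. if j \<in> {1..m} then (\<Sum>i=1..n. l j y + \<delta> i j \<omega>) / real n else 0)"

end

theory Submission
  imports Defs
begin

text \<open>
  With \<open>x = K\<^sup>+ y\<close> the error splits into the bias \<open>R\<^sub>\<alpha> y - x\<close>, the propagated discretisation error
  \<open>R\<^sub>\<alpha> (P\<^sup>+ P y - y)\<close> and the propagated noise. In the eigenbasis of \<open>K\<^sup>* K\<close> the bias has the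
  components \<open>(\<mu> F\<^sub>\<alpha>(\<mu>) - 1) Q\<^sub>\<mu> x\<close>, which are dominated and tend to zero one by one. The other two
  terms are controlled by \<open>\<parallel>R\<^sub>\<alpha>\<parallel>\<^sup>2 \<le> C\<^sub>R C\<^sub>F / \<alpha>\<close>; averaging \<open>n\<close> measurements makes
  the mean square of the noise at most \<open>C\<^sub>d m / (n c\<^sup>2) \<le> C\<^sub>d \<delta>\<^sup>2\<close>, so both are \<open>O(\<delta>\<^sup>2 / \<alpha>)\<close>.
\<close>

section \<open>Hilbert spaces\<close>

text \<open>\<open>fun_calc\<close> sums over eigenvalues only, so everything rests on the
  eigenprojections adding up to the identity. Injectivity of K enters there: 0 is no eigenvalue, and
  all eigenvalues lie in the interval on which the filter is controlled. Whole eigenspaces and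
  unordered sums avoid choosing bases or enumerating eigenvalues.

  The operator bound has 1/\<alpha> and not 1/\<alpha>^2 because the numbers
  \<open>(norm (Q \<mu> (adjoint K y)))\<^sup>2 / \<mu>\<close> sum to at most
  \<open>(norm y)\<^sup>2\<close>. The remaining weight
  \<open>\<mu> * (F \<alpha> \<mu>)\<^sup>2\<close> splits into
  \<open>\<mu> * \<bar>F \<alpha> \<mu>\<bar>\<close>, bounded by the constant of (ii), and
  \<open>\<bar>F \<alpha> \<mu>\<bar>\<close>, bounded through (iv). Using (iv) twice would leave
  \<delta>/\<alpha>, which the parameter choice does not control.

  \<open>adjoint\<close>, \<open>orth_proj\<close> and \<open>mp_inverse\<close> are given by
  descriptions, and an infinite sum that does not converge has the value 0. Hence existence,
  uniqueness and summability precede every computation.\<close>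

lemma parallelogram_midpoint:
  fixes x a b :: "'a::real_inner"
  shows "(norm (a - b))\<^sup>2 =
    2 * (norm (x - a))\<^sup>2 + 2 * (norm (x - b))\<^sup>2 - 4 * (norm (x - (1/2) *\<^sub>R (a + b)))\<^sup>2"
  by (simp add: power2_norm_eq_inner inner_diff_left inner_diff_right inner_add_left
      inner_add_right inner_commute algebra_simps)

text \<open>The point p is the nearest point of S to x. A minimising sequence is Cauchy by the
  parallelogram law, and since moving p along a vector v of S cannot shorten x - p, the inner
  product with v vanishes.\<close>

lemma orthogonal_decomposition_exists:
  fixes S :: "'a::{real_inner,complete_space} set"
  assumes "closed S" "subspace S"
  obtains p where "p \<in> S" "x - p \<in> orthogonal_comp S"
proof -
  define d where "d = infdist x S"
  have ne: "S \<noteq> {}" using assms(2) subspace_0 by auto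
  have d_le: "d \<le> norm (x - a)" if "a \<in> S" for a
    using infdist_le[OF that, of x] by (simp add: d_def dist_norm)
  have d0: "0 \<le> d" by (simp add: d_def infdist_nonneg)
  have "\<exists>a\<in>S. norm (x - a) < d + 1 / Suc n" for n
  proof -
    have "Inf (dist x ` S) < d + 1 / Suc n"
      using ne by (simp add: d_def infdist_notempty)
    then show ?thesis using cInf_lessD[of "dist x ` S"] ne by (force simp: dist_norm)
  qed
  then obtain s where s: "\<And>n. s n \<in> S" "\<And>n. norm (x - s n) < d + 1 / Suc n"
    by metis
  have lim: "(\<lambda>n. norm (x - s n)) \<longlonglongrightarrow> d"
  proof (rule tendsto_sandwich[of "\<lambda>_. d"])
    show "(\<lambda>n. d + 1 / Suc n) \<longlonglongrightarrow> d"
      using tendsto_add[OF tendsto_const LIMSEQ_inverse_real_of_nat, of d]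
      by (simp add: inverse_eq_divide)
    show "\<forall>\<^sub>F n in sequentially. norm (x - s n) \<le> d + 1 / Suc n"
      using s(2) by (auto intro: less_imp_le always_eventually)
  qed (use d_le s(1) in auto)
  \<comment> \<open>The midpoint of two points of S lies in S, so its distance from x is at least d;
    the parallelogram law turns this into closeness of two near-minimisers.\<close>
  have sq: "(norm (s m - s n))\<^sup>2 \<le> 2 * ((norm (x - s m))\<^sup>2 - d\<^sup>2) + 2 * ((norm (x - s n))\<^sup>2 - d\<^sup>2)"
    for m n
  proof -
    have "(1/2) *\<^sub>R (s m + s n) \<in> S"
      using s(1) assms(2) by (simp add: subspace_add subspace_scale)
    then have "d\<^sup>2 \<le> (norm (x - (1/2) *\<^sub>R (s m + s n)))\<^sup>2"
      using d_le d0 by (simp add: power_mono)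
    then show ?thesis
      using parallelogram_midpoint[of "s m" "s n" x] by simp
  qed
  have "(\<lambda>n. (norm (x - s n))\<^sup>2 - d\<^sup>2) \<longlonglongrightarrow> d\<^sup>2 - d\<^sup>2"
    by (intro tendsto_intros lim)
  then have lim0: "(\<lambda>n. (norm (x - s n))\<^sup>2 - d\<^sup>2) \<longlonglongrightarrow> 0" by simp
  have "Cauchy s"
  proof (rule metric_CauchyI)
    fix e :: real assume e: "e > 0"
    then have "\<forall>\<^sub>F n in sequentially. (norm (x - s n))\<^sup>2 - d\<^sup>2 < e\<^sup>2 / 4"
      using order_tendstoD(2)[OF lim0, of "e\<^sup>2 / 4"] by simp
    then obtain N where N: "\<And>n. n \<ge> N \<Longrightarrow> (norm (x - s n))\<^sup>2 - d\<^sup>2 < e\<^sup>2 / 4"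
      by (auto simp: eventually_sequentially)
    have "dist (s m) (s n) < e" if "m \<ge> N" "n \<ge> N" for m n
    proof -
      have "a < E" if "a \<le> 2 * b + 2 * c" "b < E / 4" "c < E / 4" for a b c E :: real
        using that by simp
      from this[OF sq N[OF that(1)] N[OF that(2)]] have "(norm (s m - s n))\<^sup>2 < e\<^sup>2" .
      then have "norm (s m - s n) < e" by (rule power2_less_imp_less) (use e in simp)
      then show ?thesis by (simp add: dist_norm)
    qed
    then show "\<exists>M. \<forall>m\<ge>M. \<forall>n\<ge>M. dist (s m) (s n) < e" by blast
  qed
  then obtain p where p: "s \<longlonglongrightarrow> p" by (auto simp: convergent_eq_Cauchy[symmetric])
  have pS: "p \<in> S" using closed_sequentially[OF assms(1) _ p] s(1) by auto
  have "(\<lambda>n. norm (x - s n)) \<longlonglongrightarrow> norm (x - p)" by (intro tendsto_intros p)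
  then have pd: "norm (x - p) = d" using LIMSEQ_unique lim by blast
  have "inner (x - p) v = 0" if "v \<in> S" for v
  proof (cases "v = 0")
    case False
    \<comment> \<open>This t minimises the distance from x to p + t v over all real t.\<close>
    define t where "t = inner (x - p) v / inner v v"
    have vv: "inner v v > 0" using False by simp
    have "p + t *\<^sub>R v \<in> S" using pS that assms(2) by (simp add: subspace_add subspace_scale)
    then have "d\<^sup>2 \<le> (norm (x - (p + t *\<^sub>R v)))\<^sup>2" using d_le d0 by (simp add: power_mono)
    also have "\<dots> = (norm (x - p - t *\<^sub>R v))\<^sup>2" by (simp add: algebra_simps)
    also have "\<dots> = (norm (x - p))\<^sup>2 - 2 * t * inner (x - p) v + t\<^sup>2 * inner v v"
      unfolding power2_norm_eq_inner
      by (simp add: inner_diff_left inner_diff_right inner_commute algebra_simps power2_eq_square)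
    also have "\<dots> = d\<^sup>2 - (inner (x - p) v)\<^sup>2 / inner v v"
      using vv by (simp add: pd t_def power2_eq_square field_simps)
    finally have "(inner (x - p) v)\<^sup>2 / inner v v \<le> 0" by simp
    then show ?thesis using vv by (simp add: divide_le_0_iff) 
  qed simp
  then have "x - p \<in> orthogonal_comp S"
    by (auto simp: orthogonal_comp_def orthogonal_def inner_commute)
  with pS that show ?thesis by blast
qed

lemma orthogonal_decomposition_unique:
  fixes S :: "'a::real_inner set"
  assumes "subspace S" "p \<in> S" "x - p \<in> orthogonal_comp S" "q \<in> S" "x - q \<in> orthogonal_comp S"
  shows "p = q"
proof -
  have "p - q \<in> S" using assms by (simp add: subspace_diff)
  then have "inner (p - q) (x - p) = 0" "inner (p - q) (x - q) = 0"
    using assms by (auto simp: orthogonal_comp_def orthogonal_def)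
  then have "inner (p - q) ((x - q) - (x - p)) = 0"
    by (subst inner_diff_right) simp
  then have "inner (p - q) (p - q) = 0" by simp
  then show ?thesis unfolding inner_eq_zero_iff by simp
qed

lemma orth_proj_eq:
  assumes "subspace S" "p \<in> S" "x - p \<in> orthogonal_comp S"
  shows "orth_proj S x = p"
  unfolding orth_proj_def
  by (rule the_equality) (use assms orthogonal_decomposition_unique in blast)+

lemma orth_proj:
  fixes S :: "'a::{real_inner,complete_space} set"
  assumes "closed S" "subspace S"
  shows "orth_proj S x \<in> S" "x - orth_proj S x \<in> orthogonal_comp S"
  by (metis assms orth_proj_eq orthogonal_decomposition_exists)+

lemma orth_proj_inner:
  fixes S :: "'a::{real_inner,complete_space} set"
  assumes "closed S" "subspace S" "v \<in> S"
  shows "inner (orth_proj S x) v = inner x v"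
  using orth_proj(2)[OF assms(1,2), of x] assms(3)
  by (simp add: orthogonal_comp_def orthogonal_def inner_diff_right inner_commute)

text \<open>The kernel of f is closed, and one vector u orthogonal to it determines f: subtracting
  (f x / f u) u from x leaves a vector of the kernel, hence one orthogonal to u.\<close>

lemma riesz_representation:
  fixes f :: "'a::{real_inner,complete_space} \<Rightarrow> real"
  assumes "bounded_linear f"
  obtains z where "\<And>x. f x = inner x z"
proof (cases "\<forall>x. f x = 0")
  case True
  then show ?thesis using that[of 0] by simp
next
  case False
  then obtain w where w: "f w \<noteq> 0" by blast
  interpret f: bounded_linear f by fact
  define N where "N = {x. f x = 0}"
  have "closed (f -` {0})"
    by (intro closed_vimage) (auto intro!: linear_continuous_on assms continuous_on_subset)
  then have "closed N" by (simp add: N_def vimage_def)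
  moreover have sN: "subspace N"
    by (auto simp: N_def subspace_def f.add f.scaleR f.zero)
  ultimately obtain p where p: "p \<in> N" "w - p \<in> orthogonal_comp N"
    using orthogonal_decomposition_exists by blast
  define u where "u = w - p"
  have fu: "f u = f w" using p(1) by (simp add: u_def f.diff N_def)
  have u0: "inner u u \<noteq> 0" using fu w f.zero by auto
  have "f x = inner x ((f u / inner u u) *\<^sub>R u)" for x
  proof -
    have "x - (f x / f u) *\<^sub>R u \<in> N" using fu w by (simp add: N_def f.diff f.scaleR)
    then have "inner (x - (f x / f u) *\<^sub>R u) u = 0"
      using p(2) by (auto simp: orthogonal_comp_def orthogonal_def u_def)
    then have "inner x u = (f x / f u) * inner u u" by (simp add: inner_diff_left)
    then show ?thesis using u0 fu w by (simp add: field_simps)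
  qed
  then show ?thesis using that by blast
qed

text \<open>\<open>adjoint\<close> merely chooses a map with this property. That one exists comes
  from the Riesz representers of the functionals \<open>\<lambda>x. inner (K x) y\<close>.\<close>

lemma adjoint_inner:
  fixes K :: "'a::{real_inner,complete_space} \<Rightarrow> 'b::real_inner"
  assumes "bounded_linear K"
  shows "inner (K x) y = inner x (adjoint K y)"
proof -
  have "\<exists>z. \<forall>x. inner (K x) y = inner x z" for y
    using riesz_representation[OF bounded_linear_inner_left_comp[OF assms, of y]] by metis
  then obtain g where "\<forall>x y. inner (K x) y = inner x (g y)" by metis
  then show ?thesis using adjoint_unique by metis
qed

text \<open>Unordered sums are limits along the filter of finite subsets of an arbitrary index set,
  so completeness is wanted for Cauchy filters and not just for sequences.\<close>

lemma complete_space_cauchy_filter: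
  fixes f :: "'i \<Rightarrow> 'b::complete_space"
  assumes "F \<noteq> bot" "cauchy_filter (filtermap f F)"
  shows "\<exists>L. (f \<longlongrightarrow> L) F"
  using assms complete_uniform[where S="UNIV::'b set"] complete_UNIV
  by (force simp: filterlim_def)

text \<open>By Pythagoras, the squared norm of the sum over a finite set is the sum of the squared
  norms. The partial sums are therefore Cauchy because those of a bounded nonnegative series are,
  and the bound on finite sums survives the limit.\<close>

lemma orthogonal_family_summable:
  fixes g :: "'i \<Rightarrow> 'a::{real_inner,complete_space}"
  assumes orth: "pairwise (\<lambda>i j. orthogonal (g i) (g j)) I"
    and bound: "\<And>S. finite S \<Longrightarrow> S \<subseteq> I \<Longrightarrow> (\<Sum>i\<in>S. (norm (g i))\<^sup>2) \<le> B"
  shows "g summable_on I" "(norm (infsum g I))\<^sup>2 \<le> B"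
proof -
  have pyth: "(norm (sum g S))\<^sup>2 = (\<Sum>i\<in>S. (norm (g i))\<^sup>2)" if "finite S" "S \<subseteq> I" for S
    using norm_sum_Pythagorean[OF that(1) pairwise_subset[OF orth that(2)]] .
  have "(\<lambda>i. (norm (g i))\<^sup>2) summable_on I"
    using bound by (intro nonneg_bdd_above_summable_on bdd_aboveI[where M=B]) auto
  then obtain s where s: "((\<lambda>i. (norm (g i))\<^sup>2) has_sum s) I" by (auto simp: summable_on_def)
  have "\<exists>P. eventually P (finite_subsets_at_top I) \<and>
      (\<forall>S T. P S \<and> P T \<longrightarrow> dist (sum g S) (sum g T) < e)" if e: "e > 0" for e
  proof -
    \<comment> \<open>The tail bound e^2/8 is strictly below (e/2)^2, so any two finite sets
      containing S0 have sums closer than e.\<close>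
    obtain S0 where S0: "finite S0" "S0 \<subseteq> I" "dist (\<Sum>i\<in>S0. (norm (g i))\<^sup>2) s \<le> e\<^sup>2 / 8"
      using has_sum_finite_approximation[OF s, of "e\<^sup>2 / 8"] e by auto
    define P where "P S \<longleftrightarrow> finite S \<and> S0 \<subseteq> S \<and> S \<subseteq> I" for S
    have near: "dist (sum g S) (sum g S0) < e / 2" if "P S" for S
    proof -
      have fS: "finite S" "S0 \<subseteq> S" "S \<subseteq> I" using that by (auto simp: P_def)
      have "(\<Sum>i\<in>S. (norm (g i))\<^sup>2) \<le> s"
        using fS by (intro has_sum_mono2[OF has_sum_finite s]) auto
      then have "(\<Sum>i\<in>S - S0. (norm (g i))\<^sup>2) \<le> e\<^sup>2 / 8"
        using S0 fS unfolding dist_real_def by (subst sum_diff) linarith+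
      moreover have "S - S0 \<subseteq> I" using fS by blast
      ultimately have "(norm (sum g (S - S0)))\<^sup>2 \<le> e\<^sup>2 / 8" using pyth[of "S - S0"] fS by simp
      also have "e\<^sup>2 / 8 < (e / 2)\<^sup>2" using e by (simp add: power2_eq_square)
      finally have "norm (sum g (S - S0)) < e / 2" by (rule power2_less_imp_less) (use e in simp)
      then show ?thesis using S0 fS by (simp add: sum_diff dist_norm)
    qed
    have "dist (sum g S) (sum g T) < e" if "P S" "P T" for S T
      using dist_triangle_half_l[OF near[OF that(1)] near[OF that(2)]] .
    moreover have "eventually P (finite_subsets_at_top I)"
      unfolding eventually_finite_subsets_at_top P_def using S0 by blast
    ultimately show ?thesis by blast
  qed
  then have "cauchy_filter (filtermap (sum g) (finite_subsets_at_top I))"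
    by (simp add: cauchy_filter_metric_filtermap)
  then show summ: "g summable_on I"
    unfolding summable_on_def has_sum_def by (intro complete_space_cauchy_filter) auto
  have "((\<lambda>S. (norm (sum g S))\<^sup>2) \<longlongrightarrow> (norm (infsum g I))\<^sup>2) (finite_subsets_at_top I)"
    using has_sum_infsum[OF summ] by (intro tendsto_intros) (auto simp: has_sum_def)
  moreover have "\<forall>\<^sub>F S in finite_subsets_at_top I. (norm (sum g S))\<^sup>2 \<le> B"
    using pyth bound by (intro eventually_finite_subsets_at_top_weakI) auto
  ultimately show "(norm (infsum g I))\<^sup>2 \<le> B"
    by (intro tendsto_upperbound) auto
qed

text \<open>The third assumption makes each vector e i the component of x in its own direction. No
  normalisation is required, so the lemma applies directly to projections onto whole
  eigenspaces.\<close>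

lemma bessel_inequality:
  fixes e :: "'i \<Rightarrow> 'a::real_inner"
  assumes "finite S" "pairwise (\<lambda>i j. orthogonal (e i) (e j)) S"
    and "\<And>i. i \<in> S \<Longrightarrow> inner x (e i) = (norm (e i))\<^sup>2"
  shows "(norm (x - sum e S))\<^sup>2 = (norm x)\<^sup>2 - (\<Sum>i\<in>S. (norm (e i))\<^sup>2)"
proof -
  have "(norm (x - sum e S))\<^sup>2 = (norm x)\<^sup>2 - 2 * inner x (sum e S) + (norm (sum e S))\<^sup>2"
    by (simp add: power2_norm_eq_inner inner_diff_left inner_diff_right inner_commute)
  also have "inner x (sum e S) = (\<Sum>i\<in>S. (norm (e i))\<^sup>2)"
    using assms(3) by (simp add: inner_sum_right)
  also have "(norm (sum e S))\<^sup>2 = (\<Sum>i\<in>S. (norm (e i))\<^sup>2)"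
    using norm_sum_Pythagorean[OF assms(1,2)] .
  finally show ?thesis by simp
qed

section \<open>The spectral resolution\<close>

locale compact_injective_operator =
  fixes K :: "'a::{real_inner,complete_space} \<Rightarrow> 'b::{real_inner,complete_space}"
  assumes compact_K: "compact_operator K" and inj_K: "inj K"
begin

lemma bounded_linear_K: "bounded_linear K"
proof -
  have lin: "linear K" using compact_K by (simp add: compact_operator_def)
  interpret linear K by fact
  have "bounded (K ` cball 0 1)"
    using compact_K compact_imp_bounded bounded_subset closure_subset
    unfolding compact_operator_def by (metis bounded_cball)
  then obtain B where "\<forall>y\<in>K ` cball 0 1. norm y \<le> B"
    unfolding bounded_iff by blast
  then have B: "norm (K x) \<le> B" if "norm x \<le> 1" for x
    using that by simp
  have "norm (K x) \<le> norm x * B" for x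
  proof (cases "x = 0")
    case False
    then have "norm (K (inverse (norm x) *\<^sub>R x)) \<le> B" by (intro B) simp
    then show ?thesis using False by (simp add: scale field_simps)
  qed (simp add: zero)
  then show ?thesis
    by (intro bounded_linear_intro) (auto simp: add scale)
qed

sublocale K: bounded_linear K by (rule bounded_linear_K)

lemma norm_K_le: "norm (K x) \<le> onorm K * norm x"
  using onorm[OF bounded_linear_K] .

lemma K_adjoint: "inner (K x) y = inner x (adjoint K y)" "inner y (K x) = inner (adjoint K y) x"
  using adjoint_inner[OF bounded_linear_K] by (simp_all add: inner_commute)

lemma bounded_linear_adjoint: "bounded_linear (adjoint K)"
proof (rule bounded_linear_intro)
  show "adjoint K (y + z) = adjoint K y + adjoint K z" for y z
    by (subst vector_eq_ldot[symmetric]) (simp add: K_adjoint[symmetric] inner_add_right)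
  show "adjoint K (r *\<^sub>R y) = r *\<^sub>R adjoint K y" for r y
    by (subst vector_eq_ldot[symmetric]) (simp add: K_adjoint[symmetric])
  show "norm (adjoint K y) \<le> norm y * onorm K" for y
  proof (cases "adjoint K y = 0")
    case False
    have "(norm (adjoint K y))\<^sup>2 = inner (K (adjoint K y)) y"
      by (simp add: power2_norm_eq_inner K_adjoint)
    also have "\<dots> \<le> norm (K (adjoint K y)) * norm y" by (rule norm_cauchy_schwarz)
    also have "\<dots> \<le> onorm K * norm (adjoint K y) * norm y"
      by (intro mult_right_mono norm_K_le) simp
    finally have "norm (adjoint K y) * norm (adjoint K y) \<le> norm (adjoint K y) * (norm y * onorm K)"
      by (simp add: power2_eq_square ac_simps)
    then show ?thesis using False by simp
  qed (simp add: onorm_pos_le[OF bounded_linear_K])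
qed

sublocale adj: bounded_linear "adjoint K" by (rule bounded_linear_adjoint)

abbreviation A :: "'a \<Rightarrow> 'a" where "A \<equiv> adjoint K \<circ> K"

lemma bounded_linear_A: "bounded_linear A"
  unfolding comp_def by (rule bounded_linear_compose[OF bounded_linear_adjoint bounded_linear_K])

sublocale A: bounded_linear A by (rule bounded_linear_A)

lemma inner_A: "inner (A x) y = inner (K x) (K y)"
  using K_adjoint(2)[of "K x" y] by simp

section \<open>Eigenvalues and eigenprojections of the normal operator\<close>

definition spec :: "real set" where "spec = {\<mu>. \<exists>v. v \<noteq> 0 \<and> A v = \<mu> *\<^sub>R v}"

abbreviation E :: "real \<Rightarrow> 'a set" where "E \<equiv> eigenspace A"

abbreviation Q :: "real \<Rightarrow> 'a \<Rightarrow> 'a" where "Q \<mu> \<equiv> orth_proj (E \<mu>)"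

lemma subspace_E: "subspace (E \<mu>)"
  by (auto simp: eigenspace_def subspace_def A.add A.scaleR A.zero scaleR_add_right simp del: comp_apply)

lemma closed_E: "closed (E \<mu>)"
  unfolding eigenspace_def
  by (intro closed_Collect_eq continuous_intros linear_continuous_on bounded_linear_A)

lemma Q_in_E: "Q \<mu> x \<in> E \<mu>" and Q_inner: "v \<in> E \<mu> \<Longrightarrow> inner (Q \<mu> x) v = inner x v"
  using orth_proj(1)[OF closed_E subspace_E] orth_proj_inner[OF closed_E subspace_E] by auto

text \<open>Testing against the eigenspace identifies the projection; additivity of Q and its
  behaviour under A are read off from this criterion.\<close>

lemma Q_eqI: "p \<in> E \<mu> \<Longrightarrow> (\<And>v. v \<in> E \<mu> \<Longrightarrow> inner p v = inner x v) \<Longrightarrow> Q \<mu> x = p"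
  by (intro orth_proj_eq subspace_E)
     (auto simp: orthogonal_comp_def orthogonal_def inner_diff_right inner_commute)

lemma Q_add: "Q \<mu> (x + y) = Q \<mu> x + Q \<mu> y"
  by (rule Q_eqI) (simp_all add: Q_in_E Q_inner inner_add_left subspace_add[OF subspace_E])

lemma inner_K_eigenvector: "v \<in> E \<mu> \<Longrightarrow> inner (K v) (K w) = \<mu> * inner v w"
  by (simp add: inner_A[symmetric] eigenspace_def)

lemma Q_A: "Q \<mu> (A x) = \<mu> *\<^sub>R Q \<mu> x"
proof (rule Q_eqI)
  fix v assume "v \<in> E \<mu>"
  then have "inner (A x) v = \<mu> * inner x v" "inner (Q \<mu> x) v = inner x v"
    using inner_K_eigenvector[of v \<mu> x] Q_inner inner_A[of x v] by (simp_all add: inner_commute)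
  then show "inner (\<mu> *\<^sub>R Q \<mu> x) v = inner (A x) v" by simp
qed (simp add: Q_in_E subspace_scale[OF subspace_E])

lemma eigenspaces_orthogonal:
  assumes "v \<in> E \<mu>" "w \<in> E \<nu>" "\<mu> \<noteq> \<nu>"
  shows "inner v w = 0"
proof -
  have "\<mu> * inner v w = \<nu> * inner v w"
    using inner_K_eigenvector[OF assms(1), of w] inner_K_eigenvector[OF assms(2), of v]
    by (simp add: inner_commute)
  then show ?thesis using assms(3) by simp
qed

lemma K_eq_0_iff: "K x = 0 \<longleftrightarrow> x = 0"
  using inj_K K.zero by (metis injD)

text \<open>An eigenvector v satisfies ||K v||^2 = \<mu> ||v||^2. Injectivity makes the left side
  positive, and the operator norm bounds it from above. The resulting interval is the one in the
  filter conditions.\<close>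

lemma spec_bounds:
  assumes "\<mu> \<in> spec"
  shows "\<mu> \<in> {0<..(onorm K)\<^sup>2}"
proof -
  obtain v where v: "v \<noteq> 0" "v \<in> E \<mu>" using assms by (auto simp: spec_def eigenspace_def)
  then have eq: "(norm (K v))\<^sup>2 = \<mu> * (norm v)\<^sup>2"
    using inner_K_eigenvector[OF v(2), of v] by (simp add: power2_norm_eq_inner)
  have "(norm (K v))\<^sup>2 > 0" using v(1) K_eq_0_iff by simp
  then have "\<mu> > 0" using eq v(1) by (simp add: zero_less_mult_iff)
  moreover have "(norm (K v))\<^sup>2 \<le> (onorm K * norm v)\<^sup>2"
    using norm_K_le by (intro power_mono) auto
  then have "\<mu> * (norm v)\<^sup>2 \<le> (onorm K)\<^sup>2 * (norm v)\<^sup>2" by (simp add: eq power_mult_distrib)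
  then have "\<mu> \<le> (onorm K)\<^sup>2" using v(1) by simp
  ultimately show ?thesis by simp
qed

text \<open>A unit vector of \<open>W\<close> at which \<open>\<parallel>K x\<parallel>\<close> is maximal is an eigenvector; it is the limit of a maximising
  sequence along which \<open>K\<close> converges.\<close>

lemma invariant_subspace_eigenvector:
  assumes W: "closed W" "subspace W" "\<And>x. x \<in> W \<Longrightarrow> A x \<in> W" and w: "w \<in> W" "w \<noteq> 0"
  obtains v \<mu> where "v \<in> W" "v \<noteq> 0" "A v = \<mu> *\<^sub>R v"
proof -
  define U where "U = {x \<in> W. norm x = 1}"
  define s where "s = (SUP x\<in>U. norm (K x))"
  have unit: "inverse (norm x) *\<^sub>R x \<in> U" if "x \<in> W" "x \<noteq> 0" for x
    using that W(2) by (simp add: U_def subspace_scale)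
  have Une: "U \<noteq> {}" using unit[OF w] by auto
  have bdd: "bdd_above ((\<lambda>x. norm (K x)) ` U)"
  proof (rule bdd_aboveI2)
    show "norm (K x) \<le> onorm K" if "x \<in> U" for x
      using norm_K_le[of x] that by (simp add: U_def)
  qed
  have upper_U: "norm (K x) \<le> s" if "x \<in> U" for x
    unfolding s_def using cSUP_upper[OF that bdd] .
  have upper: "norm (K x) \<le> s * norm x" if "x \<in> W" for x
  proof (cases "x = 0")
    case False
    then show ?thesis using upper_U[OF unit[OF that False]] by (simp add: K.scaleR field_simps)
  qed (simp add: K.zero)
  \<comment> \<open>Injectivity is what makes s positive; the limit of the maximising sequence is
    later recovered by dividing by s^2.\<close>
  have "0 < norm (K w)" using w K_eq_0_iff by simp
  also have "\<dots> \<le> s * norm w" using upper[OF w(1)] .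
  finally have s0: "s > 0" using w(2) by (simp add: zero_less_mult_iff)
  have "\<exists>x\<in>U. s - 1 / Suc k < norm (K x)" for k
  proof -
    have "s - 1 / Suc k < (SUP x\<in>U. norm (K x))" by (simp add: s_def)
    then show ?thesis using less_cSUP_iff[OF Une bdd] by blast
  qed
  then obtain x where x: "\<And>k. x k \<in> U" "\<And>k. s - 1 / Suc k < norm (K (x k))" by metis
  have xW: "x k \<in> W" "norm (x k) = 1" for k using x(1)[of k] by (auto simp: U_def)
  have lim: "(\<lambda>k. norm (K (x k))) \<longlonglongrightarrow> s"
  proof (rule tendsto_sandwich)
    show "(\<lambda>k. s - 1 / Suc k) \<longlonglongrightarrow> s"
      using tendsto_diff[OF tendsto_const LIMSEQ_inverse_real_of_nat, of s]
      by (simp add: inverse_eq_divide)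
    show "\<forall>\<^sub>F k in sequentially. s - 1 / Suc k \<le> norm (K (x k))"
      using x(2) by (auto intro: less_imp_le always_eventually)
    show "\<forall>\<^sub>F k in sequentially. norm (K (x k)) \<le> s" using upper_U x(1) by auto
  qed auto
  have "compact (closure (K ` cball 0 1))"
    using compact_K bounded_cball by (auto simp: compact_operator_def)
  moreover have "K (x k) \<in> closure (K ` cball 0 1)" for k
    using closure_subset[of "K ` cball 0 1"] xW(2)[of k] by auto
  ultimately obtain y r where r: "strict_mono r" "(\<lambda>k. K (x (r k))) \<longlonglongrightarrow> y"
    unfolding compact_def comp_def by meson
  have limA: "(\<lambda>k. A (x (r k))) \<longlonglongrightarrow> adjoint K y"
    using adj.tendsto[OF r(2)] by simp
  \<comment> \<open>Invariance of W allows the maximality bound to be applied a second time, to A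
    u.\<close>
  have A_le: "norm (A u) \<le> s * norm (K u)" if "u \<in> W" for u
  proof (cases "A u = 0")
    case False
    have "(norm (A u))\<^sup>2 = inner (K u) (K (A u))"
      by (simp add: power2_norm_eq_inner inner_A[of u "A u"] del: comp_apply)
    also have "\<dots> \<le> norm (K u) * norm (K (A u))" by (rule norm_cauchy_schwarz)
    also have "\<dots> \<le> norm (K u) * (s * norm (A u))"
      by (intro mult_left_mono upper W(3) that) simp
    finally have "norm (A u) * norm (A u) \<le> norm (A u) * (s * norm (K u))"
      by (simp add: power2_eq_square ac_simps del: comp_apply)
    then show ?thesis using False by (simp del: comp_apply)
  qed (use s0 in simp)
  \<comment> \<open>Expanding the square and inserting \<open>A_le\<close> leaves s^2 (s^2 - ||K
    u||^2). This tends to 0 along a maximising sequence, which thus consists of approximate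
    eigenvectors for the eigenvalue s^2.\<close>
  have defect: "(norm (A u - s\<^sup>2 *\<^sub>R u))\<^sup>2 \<le> s\<^sup>2 * (s\<^sup>2 - (norm (K u))\<^sup>2)" if "u \<in> W" "norm u = 1" for u
  proof -
    have "(norm (A u - s\<^sup>2 *\<^sub>R u))\<^sup>2 = (norm (A u))\<^sup>2 - 2 * s\<^sup>2 * inner (A u) u + (s\<^sup>2)\<^sup>2 * (norm u)\<^sup>2"
      unfolding power2_norm_eq_inner
      by (simp add: inner_diff_left inner_diff_right inner_commute power2_eq_square algebra_simps
          del: comp_apply)
    also have "inner (A u) u = (norm (K u))\<^sup>2" unfolding power2_norm_eq_inner by (rule inner_A)
    also have "(norm (A u))\<^sup>2 \<le> (s * norm (K u))\<^sup>2"
      by (intro power_mono A_le that) simp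
    finally show ?thesis using that(2) by (simp add: power2_eq_square algebra_simps del: comp_apply)
  qed
  have "(\<lambda>k. s\<^sup>2 * (s\<^sup>2 - (norm (K (x (r k))))\<^sup>2)) \<longlonglongrightarrow> s\<^sup>2 * (s\<^sup>2 - s\<^sup>2)"
    using LIMSEQ_subseq_LIMSEQ[OF lim r(1)] by (intro tendsto_intros) (simp add: comp_def)
  then have lim0: "(\<lambda>k. s\<^sup>2 * (s\<^sup>2 - (norm (K (x (r k))))\<^sup>2)) \<longlonglongrightarrow> 0" by simp
  have "(\<lambda>k. (norm (A (x (r k)) - s\<^sup>2 *\<^sub>R x (r k)))\<^sup>2) \<longlonglongrightarrow> 0"
  proof (rule tendsto_sandwich[OF _ _ tendsto_const lim0])
    show "\<forall>\<^sub>F k in sequentially. (norm (A (x (r k)) - s\<^sup>2 *\<^sub>R x (r k)))\<^sup>2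
        \<le> s\<^sup>2 * (s\<^sup>2 - (norm (K (x (r k))))\<^sup>2)"
      by (intro always_eventually allI defect xW)
  qed (intro always_eventually allI zero_le_power2)
  from tendsto_real_sqrt[OF this]
  have "(\<lambda>k. norm (A (x (r k)) - s\<^sup>2 *\<^sub>R x (r k))) \<longlonglongrightarrow> 0"
    by (simp del: comp_apply)
  then have "(\<lambda>k. A (x (r k)) - s\<^sup>2 *\<^sub>R x (r k)) \<longlonglongrightarrow> 0"
    by (rule tendsto_norm_zero_cancel)
  \<comment> \<open>Compactness gives convergence of the images under A only; the vanishing defect
    transfers it to the vectors themselves.\<close>
  from tendsto_diff[OF limA this] have "(\<lambda>k. s\<^sup>2 *\<^sub>R x (r k)) \<longlonglongrightarrow> adjoint K y" by simp
  from tendsto_scaleR[OF tendsto_const this, of "inverse (s\<^sup>2)"]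
  have limx: "(\<lambda>k. x (r k)) \<longlonglongrightarrow> inverse (s\<^sup>2) *\<^sub>R adjoint K y" using s0 by simp
  define e where "e = inverse (s\<^sup>2) *\<^sub>R adjoint K y"
  have "e \<in> W" using closed_sequentially[OF W(1) _ limx] xW by (auto simp: e_def)
  moreover have "norm e = 1"
    using LIMSEQ_unique[OF tendsto_norm[OF limx]] xW by (simp add: e_def)
  then have "e \<noteq> 0" by auto
  moreover have "A e = adjoint K y"
    using LIMSEQ_unique[OF A.tendsto[OF limx] limA] by (simp add: e_def)
  then have "A e = s\<^sup>2 *\<^sub>R e" using s0 by (simp add: e_def)
  ultimately show ?thesis using that by blast
qed

lemma Q_norm_sq: "inner x (Q \<mu> x) = (norm (Q \<mu> x))\<^sup>2"
  using Q_inner[OF Q_in_E, of \<mu> x x] by (simp add: power2_norm_eq_inner)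

lemma Q_orthogonal: "pairwise (\<lambda>\<mu> \<nu>. orthogonal (f \<mu> *\<^sub>R Q \<mu> x) (g \<nu> *\<^sub>R Q \<nu> y)) I"
  by (auto simp: pairwise_def orthogonal_def eigenspaces_orthogonal[OF Q_in_E Q_in_E])

lemma Q_bessel:
  "finite S \<Longrightarrow> (norm (x - (\<Sum>\<mu>\<in>S. Q \<mu> x)))\<^sup>2 = (norm x)\<^sup>2 - (\<Sum>\<mu>\<in>S. (norm (Q \<mu> x))\<^sup>2)"
  using Q_orthogonal[of "\<lambda>_. 1" x "\<lambda>_. 1" x S] by (intro bessel_inequality) (auto simp: Q_norm_sq)

lemma Q_bessel_le: "finite S \<Longrightarrow> (\<Sum>\<mu>\<in>S. (norm (Q \<mu> x))\<^sup>2) \<le> (norm x)\<^sup>2"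
  using Q_bessel[of S x] zero_le_power2[of "norm (x - (\<Sum>\<mu>\<in>S. Q \<mu> x))"] by simp

text \<open>Bessel's inequality makes the projections summable, and the difference of x and their
  sum is orthogonal to all eigenspaces. The vectors orthogonal to all eigenspaces form a closed
  A-invariant subspace W. Were the difference nonzero, W would contain an eigenvector, which would
  be orthogonal to itself.\<close>

lemma spectral_resolution: "((\<lambda>\<mu>. Q \<mu> x) has_sum x) spec"
proof -
  have summ: "(\<lambda>\<mu>. Q \<mu> x) summable_on spec"
    using Q_orthogonal[of "\<lambda>_. 1" x "\<lambda>_. 1" x spec] Q_bessel_le[of _ x]
    by (intro orthogonal_family_summable(1)[where B="(norm x)\<^sup>2"]) auto
  define p where "p = (\<Sum>\<^sub>\<infinity>\<mu>\<in>spec. Q \<mu> x)"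
  have p: "((\<lambda>\<mu>. Q \<mu> x) has_sum p) spec" using summ by (simp add: p_def)
  define W where "W = orthogonal_comp (\<Union>\<mu>\<in>spec. E \<mu>)"
  have W_iff: "u \<in> W \<longleftrightarrow> (\<forall>\<mu>\<in>spec. \<forall>v\<in>E \<mu>. inner u v = 0)" for u
    by (auto simp: W_def orthogonal_comp_def orthogonal_def inner_commute)
  have "inner p v = inner x v" if "\<mu> \<in> spec" "v \<in> E \<mu>" for \<mu> v
  proof -
    have "((\<lambda>\<nu>. inner (Q \<nu> x) v) has_sum inner p v) spec"
      using has_sum_bounded_linear[OF bounded_linear_inner_left p] .
    \<comment> \<open>Only the summand at \<mu> survives the pairing with an eigenvector for
      \<mu>.\<close>
    moreover have "((\<lambda>\<nu>. inner (Q \<nu> x) v) has_sum inner (Q \<mu> x) v) spec"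
      using eigenspaces_orthogonal[OF Q_in_E that(2)] that(1)
      by (intro has_sum_finite_neutralI[of "{\<mu>}"]) auto
    ultimately show ?thesis using has_sum_unique Q_inner[OF that(2)] by metis
  qed
  then have xp: "x - p \<in> W" by (simp add: W_iff inner_diff_left)
  have "x - p = 0"
  proof (rule ccontr)
    assume nz: "x - p \<noteq> 0"
    have "closed W"
    proof -
      have "W = (\<Inter>\<mu>\<in>spec. \<Inter>v\<in>E \<mu>. {u. inner u v = 0})" by (auto simp: W_iff)
      also have "closed \<dots>"
        by (intro closed_INT ballI closed_Collect_eq continuous_intros)
      finally show ?thesis .
    qed
    moreover have "subspace W" unfolding W_def by (rule subspace_orthogonal_comp)
    moreover have "A u \<in> W" if "u \<in> W" for u
      unfolding W_iff
    proof (intro ballI)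
      fix \<mu> v assume mv: "\<mu> \<in> spec" "v \<in> E \<mu>"
      then have "inner u v = 0" using that by (auto simp: W_iff)
      then have "inner (K v) (K u) = 0"
        using inner_K_eigenvector[OF mv(2), of u] by (simp add: inner_commute)
      then show "inner (A u) v = 0" unfolding inner_A by (simp add: inner_commute)
    qed
    ultimately obtain v \<mu> where v: "v \<in> W" "v \<noteq> 0" "A v = \<mu> *\<^sub>R v"
      using invariant_subspace_eigenvector xp nz by blast
    then have "\<mu> \<in> spec" "v \<in> E \<mu>" by (auto simp: spec_def eigenspace_def)
    then have "inner v v = 0" using v(1) W_iff by blast
    then show False using v(2) by simp
  qed
  then show ?thesis using p by simp
qed

end

section \<open>Filter regularisation\<close>

text \<open>The supremum in condition (i), taken with \<epsilon> = \<mu>, includes the point \<mu>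
  itself.\<close>

lemma regularising_filter_pointwise:
  assumes "regularising_filter \<Lambda> F \<nu>" "\<mu> \<in> {0<..\<Lambda>}"
  shows "((\<lambda>\<alpha>. F \<alpha> \<mu>) \<longlongrightarrow> 1 / \<mu>) (at_right 0)"
proof -
  have lim: "((\<lambda>\<alpha>. SUP t\<in>{\<mu>..\<Lambda>}. ennreal \<bar>F \<alpha> t - 1 / t\<bar>) \<longlongrightarrow> 0) (at_right 0)"
    using assms by (auto simp: regularising_filter_def)
  have "((\<lambda>\<alpha>. ennreal \<bar>F \<alpha> \<mu> - 1 / \<mu>\<bar>) \<longlongrightarrow> 0) (at_right 0)"
  proof (rule tendsto_sandwich[OF _ _ tendsto_const lim])
    show "\<forall>\<^sub>F \<alpha> in at_right 0. ennreal \<bar>F \<alpha> \<mu> - 1 / \<mu>\<bar>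
        \<le> (SUP t\<in>{\<mu>..\<Lambda>}. ennreal \<bar>F \<alpha> t - 1 / t\<bar>)"
      using assms(2) by (intro always_eventually allI SUP_upper) auto
  qed auto
  then have "((\<lambda>\<alpha>. \<bar>F \<alpha> \<mu> - 1 / \<mu>\<bar>) \<longlongrightarrow> 0) (at_right 0)"
    using tendsto_ennreal_iff[of "\<lambda>\<alpha>. \<bar>F \<alpha> \<mu> - 1 / \<mu>\<bar>" "at_right 0" 0] by simp
  then show ?thesis by (simp add: tendsto_rabs_zero_iff LIM_zero_iff)
qed

context compact_injective_operator
begin

text \<open>A residual orthogonal to the range of K is one annihilated by \<open>adjoint K\<close>,
  so the defining property becomes the normal equation. The domain supplies a solution; injectivity
  makes it unique and trivialises the null space condition.\<close>

lemma mp_inverse_normal_equation: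
  assumes "y \<in> mp_domain K"
  shows "adjoint K y = A (mp_inverse inner K y)"
proof -
  obtain x b where y: "y = K x + b" and b: "b \<in> orthogonal_comp (range K)"
    using assms by (auto simp: mp_domain_def)
  have eqs: "(\<forall>z. inner (y - K u) (K z) = 0) \<longleftrightarrow> adjoint K y = A u" for u
    by (metis (no_types, lifting) K_adjoint(2) comp_apply inner_diff_left adj.diff
        eq_iff_diff_eq_0 inner_eq_zero_iff inner_zero_left)
  have "\<forall>z. inner (y - K x) (K z) = 0"
    using b by (auto simp: y orthogonal_comp_def orthogonal_def inner_commute)
  then have x: "adjoint K y = A x" using eqs by blast
  have "u = x" if "adjoint K y = A u" for u
  proof -
    have "A (u - x) = 0" using that x by (simp add: A.diff del: comp_apply)
    then have "inner (K (u - x)) (K (u - x)) = 0" by (simp add: inner_A[symmetric])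
    then show ?thesis using K_eq_0_iff by simp
  qed
  moreover have "{z. K z = K 0} = {0}" using K_eq_0_iff by (auto simp: K.zero)
  ultimately have "mp_inverse inner K y = x"
    unfolding mp_inverse_def eqs using x by (intro the_equality) auto
  then show ?thesis using x by simp
qed

lemma reg_op_eq: "reg_op K F \<alpha> y = (\<Sum>\<^sub>\<infinity>\<mu>\<in>spec. F \<alpha> \<mu> *\<^sub>R Q \<mu> (adjoint K y))"
  by (simp add: reg_op_def fun_calc_def spec_def)

text \<open>The vector \<open>e \<mu>\<close> is the projection of y onto the image of the
  eigenspace under K. These images are pairwise orthogonal, and since K scales the norm on
  \<open>E \<mu>\<close> by the square root of \<mu>, the squared norm of \<open>e \<mu>\<close>
  carries the weight 1/\<mu>.\<close>

lemma weighted_bessel: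
  assumes "finite S" "S \<subseteq> spec"
  shows "(\<Sum>\<mu>\<in>S. (norm (Q \<mu> (adjoint K y)))\<^sup>2 / \<mu>) \<le> (norm y)\<^sup>2"
proof -
  define e where "e \<mu> = (1 / \<mu>) *\<^sub>R K (Q \<mu> (adjoint K y))" for \<mu>
  have pos: "\<mu> > 0" if "\<mu> \<in> S" for \<mu> using assms(2) spec_bounds that by auto
  have norm_e: "(norm (e \<mu>))\<^sup>2 = (norm (Q \<mu> (adjoint K y)))\<^sup>2 / \<mu>" if "\<mu> \<in> S" for \<mu>
  proof -
    have "(norm (K (Q \<mu> (adjoint K y))))\<^sup>2 = \<mu> * (norm (Q \<mu> (adjoint K y)))\<^sup>2"
      unfolding power2_norm_eq_inner by (rule inner_K_eigenvector[OF Q_in_E])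
    then have "(norm (e \<mu>))\<^sup>2 = (1 / \<mu>)\<^sup>2 * (\<mu> * (norm (Q \<mu> (adjoint K y)))\<^sup>2)"
      unfolding e_def norm_scaleR power_mult_distrib using pos[OF that] by simp
    then show ?thesis using pos[OF that] by (simp add: power2_eq_square)
  qed
  have "pairwise (\<lambda>\<mu> \<nu>. orthogonal (e \<mu>) (e \<nu>)) S"
    by (auto simp: pairwise_def orthogonal_def e_def inner_K_eigenvector[OF Q_in_E]
        eigenspaces_orthogonal[OF Q_in_E Q_in_E])
  moreover have "inner y (e \<mu>) = (norm (e \<mu>))\<^sup>2" if "\<mu> \<in> S" for \<mu>
    using norm_e[OF that] by (simp add: e_def K_adjoint(2) Q_norm_sq)
  ultimately have "(norm (y - sum e S))\<^sup>2 = (norm y)\<^sup>2 - (\<Sum>\<mu>\<in>S. (norm (e \<mu>))\<^sup>2)"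
    using assms(1) by (intro bessel_inequality)
  also have "(\<Sum>\<mu>\<in>S. (norm (e \<mu>))\<^sup>2) = (\<Sum>\<mu>\<in>S. (norm (Q \<mu> (adjoint K y)))\<^sup>2 / \<mu>)"
    by (intro sum.cong norm_e) auto
  finally show ?thesis using zero_le_power2[of "norm (y - sum e S)"] by simp
qed

text \<open>The square of the filter value is estimated by one factor a/\<mu> and one factor b; the
  1/\<mu> is absorbed by \<open>weighted_bessel\<close>. In the application a is the constant of
  (ii) and b is that of (iv) divided by \<alpha>.\<close>

lemma reg_op_bound:
  assumes "0 \<le> a" "0 \<le> b"
    and a: "\<And>\<mu>. \<mu> \<in> {0<..(onorm K)\<^sup>2} \<Longrightarrow> \<mu> * \<bar>F \<alpha> \<mu>\<bar> \<le> a"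
    and b: "\<And>\<mu>. \<mu> \<in> {0<..(onorm K)\<^sup>2} \<Longrightarrow> \<bar>F \<alpha> \<mu>\<bar> \<le> b"
  shows "(\<lambda>\<mu>. F \<alpha> \<mu> *\<^sub>R Q \<mu> (adjoint K y)) summable_on spec" (is ?summ)
    and "(norm (reg_op K F \<alpha> y))\<^sup>2 \<le> a * b * (norm y)\<^sup>2" (is ?bound)
proof -
  have fin: "(\<Sum>\<mu>\<in>S. (norm (F \<alpha> \<mu> *\<^sub>R Q \<mu> (adjoint K y)))\<^sup>2) \<le> a * b * (norm y)\<^sup>2"
    if S: "finite S" "S \<subseteq> spec" for S
  proof -
    have "(norm (F \<alpha> \<mu> *\<^sub>R Q \<mu> (adjoint K y)))\<^sup>2 \<le> a * b * ((norm (Q \<mu> (adjoint K y)))\<^sup>2 / \<mu>)"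
      if "\<mu> \<in> S" for \<mu>
    proof -
      have \<mu>: "\<mu> \<in> {0<..(onorm K)\<^sup>2}" using that S spec_bounds by blast
      then have "\<bar>F \<alpha> \<mu>\<bar> \<le> a / \<mu>" using a[OF \<mu>] by (simp add: field_simps)
      then have "\<bar>F \<alpha> \<mu>\<bar> * \<bar>F \<alpha> \<mu>\<bar> \<le> a / \<mu> * b"
        using b[OF \<mu>] \<mu> assms(1) by (intro mult_mono) auto
      then have "(F \<alpha> \<mu>)\<^sup>2 \<le> a * b / \<mu>" by (simp add: power2_eq_square abs_mult[symmetric])
      then have "(F \<alpha> \<mu>)\<^sup>2 * (norm (Q \<mu> (adjoint K y)))\<^sup>2 \<le> a * b / \<mu> * (norm (Q \<mu> (adjoint K y)))\<^sup>2"
        by (rule mult_right_mono) simp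
      then show ?thesis by (simp add: power_mult_distrib)
    qed
    then have "(\<Sum>\<mu>\<in>S. (norm (F \<alpha> \<mu> *\<^sub>R Q \<mu> (adjoint K y)))\<^sup>2)
        \<le> a * b * (\<Sum>\<mu>\<in>S. (norm (Q \<mu> (adjoint K y)))\<^sup>2 / \<mu>)"
      unfolding sum_distrib_left by (rule sum_mono)
    also have "\<dots> \<le> a * b * (norm y)\<^sup>2"
      using assms(1,2) weighted_bessel[OF S] by (intro mult_left_mono) auto
    finally show ?thesis .
  qed
  show ?summ ?bound unfolding reg_op_eq
    by (rule orthogonal_family_summable[OF Q_orthogonal fin]; assumption)+
qed

text \<open>Since divergent sums have the value 0, additivity is not automatic; the filter bounds
  enter only through summability.\<close>

lemma reg_op_add:
  assumes "0 \<le> a" "0 \<le> b"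
    and "\<And>\<mu>. \<mu> \<in> {0<..(onorm K)\<^sup>2} \<Longrightarrow> \<mu> * \<bar>F \<alpha> \<mu>\<bar> \<le> a"
    and "\<And>\<mu>. \<mu> \<in> {0<..(onorm K)\<^sup>2} \<Longrightarrow> \<bar>F \<alpha> \<mu>\<bar> \<le> b"
  shows "reg_op K F \<alpha> (y + z) = reg_op K F \<alpha> y + reg_op K F \<alpha> z"
  unfolding reg_op_eq adj.add Q_add scaleR_add_right
  by (intro infsum_add reg_op_bound(1)[where F=F and \<alpha>=\<alpha> and a=a and b=b] assms; assumption)

text \<open>The normal equation and \<open>Q_A\<close> replace the projection of
  \<open>adjoint K y\<close> by \<mu> times that of x; then the spectral resolution of x is
  subtracted termwise.\<close>

lemma reg_op_bias:
  assumes "0 \<le> C" and C: "\<And>\<mu>. \<mu> \<in> {0<..(onorm K)\<^sup>2} \<Longrightarrow> \<mu> * \<bar>F \<alpha> \<mu>\<bar> \<le> C"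
    and x: "adjoint K y = A x"
  shows "reg_op K F \<alpha> y - x = (\<Sum>\<^sub>\<infinity>\<mu>\<in>spec. (F \<alpha> \<mu> * \<mu> - 1) *\<^sub>R Q \<mu> x)"
proof -
  have fin: "(\<Sum>\<mu>\<in>S. (norm ((F \<alpha> \<mu> * \<mu>) *\<^sub>R Q \<mu> x))\<^sup>2) \<le> C\<^sup>2 * (norm x)\<^sup>2"
    if S: "finite S" "S \<subseteq> spec" for S
  proof -
    have "(norm ((F \<alpha> \<mu> * \<mu>) *\<^sub>R Q \<mu> x))\<^sup>2 \<le> C\<^sup>2 * (norm (Q \<mu> x))\<^sup>2" if "\<mu> \<in> S" for \<mu>
    proof -
      have \<mu>: "\<mu> \<in> {0<..(onorm K)\<^sup>2}" using that S spec_bounds by blast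
      then have "\<bar>F \<alpha> \<mu> * \<mu>\<bar> \<le> C" using C[OF \<mu>] by (simp add: abs_mult mult.commute)
      then show ?thesis unfolding norm_scaleR power_mult_distrib
        by (intro mult_right_mono power_mono) auto
    qed
    then have "(\<Sum>\<mu>\<in>S. (norm ((F \<alpha> \<mu> * \<mu>) *\<^sub>R Q \<mu> x))\<^sup>2) \<le> C\<^sup>2 * (\<Sum>\<mu>\<in>S. (norm (Q \<mu> x))\<^sup>2)"
      unfolding sum_distrib_left by (rule sum_mono)
    also have "\<dots> \<le> C\<^sup>2 * (norm x)\<^sup>2" by (intro mult_left_mono Q_bessel_le S(1)) simp
    finally show ?thesis .
  qed
  have "(\<lambda>\<mu>. (F \<alpha> \<mu> * \<mu>) *\<^sub>R Q \<mu> x) summable_on spec"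
    by (rule orthogonal_family_summable(1)[OF Q_orthogonal fin])
  moreover have eq: "reg_op K F \<alpha> y = (\<Sum>\<^sub>\<infinity>\<mu>\<in>spec. (F \<alpha> \<mu> * \<mu>) *\<^sub>R Q \<mu> x)"
    unfolding reg_op_eq x Q_A by simp
  ultimately have "((\<lambda>\<mu>. (F \<alpha> \<mu> * \<mu>) *\<^sub>R Q \<mu> x) has_sum reg_op K F \<alpha> y) spec" by simp
  from has_sum_add[OF this has_sum_bounded_linear[OF bounded_linear_minus[OF bounded_linear_ident] spectral_resolution[of x]]]
  have "((\<lambda>\<mu>. (F \<alpha> \<mu> * \<mu> - 1) *\<^sub>R Q \<mu> x) has_sum (reg_op K F \<alpha> y - x)) spec"
    by (simp only: scaleR_diff_left scaleR_one add_uminus_conv_diff)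
  then show ?thesis by (rule infsumI[symmetric])
qed

lemma reg_op_converges:
  assumes "0 \<le> C"
    and C: "\<And>\<alpha> \<mu>. \<alpha> > 0 \<Longrightarrow> \<mu> \<in> {0<..(onorm K)\<^sup>2} \<Longrightarrow> \<mu> * \<bar>F \<alpha> \<mu>\<bar> \<le> C"
    and lim: "\<And>\<mu>. \<mu> \<in> {0<..(onorm K)\<^sup>2} \<Longrightarrow> ((\<lambda>\<alpha>. F \<alpha> \<mu>) \<longlongrightarrow> 1 / \<mu>) (at_right 0)"
    and x: "adjoint K y = A x"
  shows "((\<lambda>\<alpha>. reg_op K F \<alpha> y) \<longlongrightarrow> x) (at_right 0)"
proof (rule tendstoI)
  fix e :: real assume e: "e > 0"
  \<comment> \<open>Each coefficient is at most 1 + C in absolute value, so a tail of norm at most d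
    contributes at most e^2/4 to the squared error. Together with a head below e^2/2 this stays
    under e^2.\<close>
  define d where "d = e / 2 / (1 + C)"
  have d: "d > 0" using e assms(1) by (simp add: d_def)
  obtain S where S: "finite S" "S \<subseteq> spec" "dist (\<Sum>\<mu>\<in>S. Q \<mu> x) x \<le> d"
    using has_sum_finite_approximation[OF spectral_resolution d] by blast
  \<comment> \<open>By the equality in \<open>Q_bessel\<close>, the squared distance to the partial
    sum is the mass of x outside S, which limits every finite set of eigenvalues disjoint from
    S.\<close>
  have "(norm (x - (\<Sum>\<mu>\<in>S. Q \<mu> x)))\<^sup>2 \<le> d\<^sup>2"
    using S(3) by (intro power_mono) (auto simp: dist_norm norm_minus_commute)
  then have tail: "(norm x)\<^sup>2 - (\<Sum>\<mu>\<in>S. (norm (Q \<mu> x))\<^sup>2) \<le> d\<^sup>2" using Q_bessel[OF S(1)] by simp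
  have "((\<lambda>\<alpha>. \<Sum>\<mu>\<in>S. (F \<alpha> \<mu> * \<mu> - 1)\<^sup>2 * (norm (Q \<mu> x))\<^sup>2) \<longlongrightarrow>
      (\<Sum>\<mu>\<in>S. (1 / \<mu> * \<mu> - 1)\<^sup>2 * (norm (Q \<mu> x))\<^sup>2)) (at_right 0)"
    using S(2) spec_bounds by (intro tendsto_intros lim) blast
  also have "(\<Sum>\<mu>\<in>S. (1 / \<mu> * \<mu> - 1)\<^sup>2 * (norm (Q \<mu> x))\<^sup>2) = 0"
    using S(2) spec_bounds by (intro sum.neutral) fastforce
  finally have "\<forall>\<^sub>F \<alpha> in at_right 0. (\<Sum>\<mu>\<in>S. (F \<alpha> \<mu> * \<mu> - 1)\<^sup>2 * (norm (Q \<mu> x))\<^sup>2) < e\<^sup>2 / 2"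
    by (rule order_tendstoD) (use e in simp)
  moreover have "\<forall>\<^sub>F \<alpha> in at_right (0::real). \<alpha> > 0" by (simp add: eventually_at_right_less)
  ultimately show "\<forall>\<^sub>F \<alpha> in at_right 0. dist (reg_op K F \<alpha> y) x < e"
  proof eventually_elim
    fix \<alpha> :: real
    assume head: "(\<Sum>\<mu>\<in>S. (F \<alpha> \<mu> * \<mu> - 1)\<^sup>2 * (norm (Q \<mu> x))\<^sup>2) < e\<^sup>2 / 2" and \<alpha>: "\<alpha> > 0"
    define H where "H = (\<Sum>\<mu>\<in>S. (F \<alpha> \<mu> * \<mu> - 1)\<^sup>2 * (norm (Q \<mu> x))\<^sup>2)"
    \<comment> \<open>The estimate is needed for every finite T so that it passes to the infinite
      sum; T is covered by the fixed head S and the rest T - S.\<close>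
    have "(\<Sum>\<mu>\<in>T. (norm ((F \<alpha> \<mu> * \<mu> - 1) *\<^sub>R Q \<mu> x))\<^sup>2) \<le> H + (1 + C)\<^sup>2 * d\<^sup>2"
      if T: "finite T" "T \<subseteq> spec" for T
    proof -
      have "(\<Sum>\<mu>\<in>T. (norm ((F \<alpha> \<mu> * \<mu> - 1) *\<^sub>R Q \<mu> x))\<^sup>2)
          = (\<Sum>\<mu>\<in>T. (F \<alpha> \<mu> * \<mu> - 1)\<^sup>2 * (norm (Q \<mu> x))\<^sup>2)"
        unfolding norm_scaleR power_mult_distrib power2_abs ..
      also have "\<dots> \<le> (\<Sum>\<mu>\<in>S \<union> (T - S). (F \<alpha> \<mu> * \<mu> - 1)\<^sup>2 * (norm (Q \<mu> x))\<^sup>2)"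
        using S T by (intro sum_mono2) auto
      also have "\<dots> = H + (\<Sum>\<mu>\<in>T - S. (F \<alpha> \<mu> * \<mu> - 1)\<^sup>2 * (norm (Q \<mu> x))\<^sup>2)"
        unfolding H_def using S T by (intro sum.union_disjoint) auto
      also have "\<dots> \<le> H + (\<Sum>\<mu>\<in>T - S. (1 + C)\<^sup>2 * (norm (Q \<mu> x))\<^sup>2)"
      proof (intro add_left_mono sum_mono mult_right_mono)
        fix \<mu> assume "\<mu> \<in> T - S"
        then have \<mu>: "\<mu> \<in> {0<..(onorm K)\<^sup>2}" using T spec_bounds by blast
        then have "\<bar>F \<alpha> \<mu> * \<mu>\<bar> \<le> C" using C[OF \<alpha> \<mu>] by (simp add: abs_mult mult.commute)
        then have "\<bar>F \<alpha> \<mu> * \<mu> - 1\<bar> \<le> \<bar>1 + C\<bar>" by linarith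
        then show "(F \<alpha> \<mu> * \<mu> - 1)\<^sup>2 \<le> (1 + C)\<^sup>2" unfolding abs_le_square_iff .
      qed simp
      also have "\<dots> = H + (1 + C)\<^sup>2 * (\<Sum>\<mu>\<in>T - S. (norm (Q \<mu> x))\<^sup>2)"
        unfolding sum_distrib_left ..
      also have "\<dots> \<le> H + (1 + C)\<^sup>2 * d\<^sup>2"
      proof (intro add_left_mono mult_left_mono)
        have "(\<Sum>\<mu>\<in>S. (norm (Q \<mu> x))\<^sup>2) + (\<Sum>\<mu>\<in>T - S. (norm (Q \<mu> x))\<^sup>2)
            = (\<Sum>\<mu>\<in>S \<union> (T - S). (norm (Q \<mu> x))\<^sup>2)"
          using S T by (intro sum.union_disjoint[symmetric]) auto
        also have "\<dots> \<le> (norm x)\<^sup>2" using S T by (intro Q_bessel_le) auto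
        finally show "(\<Sum>\<mu>\<in>T - S. (norm (Q \<mu> x))\<^sup>2) \<le> d\<^sup>2" using tail by simp
      qed simp
      finally show ?thesis .
    qed
    from orthogonal_family_summable(2)[OF Q_orthogonal this]
    have "(norm (\<Sum>\<^sub>\<infinity>\<mu>\<in>spec. (F \<alpha> \<mu> * \<mu> - 1) *\<^sub>R Q \<mu> x))\<^sup>2 \<le> H + (1 + C)\<^sup>2 * d\<^sup>2" .
    moreover have "reg_op K F \<alpha> y - x = (\<Sum>\<^sub>\<infinity>\<mu>\<in>spec. (F \<alpha> \<mu> * \<mu> - 1) *\<^sub>R Q \<mu> x)"
      by (rule reg_op_bias[where F=F and C=C, OF assms(1) C[OF \<alpha>] x])
    ultimately have "(norm (reg_op K F \<alpha> y - x))\<^sup>2 \<le> H + (1 + C)\<^sup>2 * d\<^sup>2" by simp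
    also have "(1 + C)\<^sup>2 * d\<^sup>2 = ((1 + C) * d)\<^sup>2" by (simp add: power_mult_distrib)
    also have "(1 + C) * d = e / 2"
    proof -
      have "1 + C \<noteq> 0" using assms(1) by simp
      from nonzero_eq_divide_eq[OF this, of d "e / 2"] show ?thesis
        by (simp only: d_def mult.commute simp_thms)
    qed
    also have "H + (e / 2)\<^sup>2 < e\<^sup>2"
    proof -
      have "(e / 2)\<^sup>2 = e\<^sup>2 / 4" by (simp add: power_divide)
      moreover have "0 < e\<^sup>2" using e by simp
      ultimately show ?thesis using head unfolding H_def[symmetric] by linarith
    qed
    finally have "norm (reg_op K F \<alpha> y - x) < e" by (rule power2_less_imp_less) (use e in simp)
    then show "dist (reg_op K F \<alpha> y) x < e" by (simp add: dist_norm)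
  qed
qed

text \<open>Here y is the exact data, y' its reconstruction from the exact samples, and z the noise
  carried back to the data space. The 3 comes from (p + q + r)^2 \<le> 3 (p^2 + q^2 + r^2).\<close>

lemma reg_op_perturbation_bound:
  assumes "0 \<le> a" "0 \<le> b"
    and a: "\<And>\<mu>. \<mu> \<in> {0<..(onorm K)\<^sup>2} \<Longrightarrow> \<mu> * \<bar>F \<alpha> \<mu>\<bar> \<le> a"
    and b: "\<And>\<mu>. \<mu> \<in> {0<..(onorm K)\<^sup>2} \<Longrightarrow> \<bar>F \<alpha> \<mu>\<bar> \<le> b"
  shows "(norm (reg_op K F \<alpha> (y' + z) - x))\<^sup>2
    \<le> 3 * (norm (reg_op K F \<alpha> y - x))\<^sup>2 + 3 * (a * b) * ((norm (y - y'))\<^sup>2 + (norm z)\<^sup>2)"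
proof -
  note add = reg_op_add[where F=F and \<alpha>=\<alpha>, OF assms]
  note bound = reg_op_bound(2)[where F=F and \<alpha>=\<alpha>, OF assms]
  define p q r where "p = norm (reg_op K F \<alpha> y - x)" and "q = norm (reg_op K F \<alpha> (y' - y))"
    and "r = norm (reg_op K F \<alpha> z)"
  have "reg_op K F \<alpha> y' = reg_op K F \<alpha> y + reg_op K F \<alpha> (y' - y)"
    using add[of y "y' - y"] by simp
  then have "reg_op K F \<alpha> (y' + z) - x
      = (reg_op K F \<alpha> y - x) + reg_op K F \<alpha> (y' - y) + reg_op K F \<alpha> z"
    using add[of y' z] by simp
  then have "norm (reg_op K F \<alpha> (y' + z) - x) \<le> p + q + r"
    unfolding p_def q_def r_def by (metis add_right_mono norm_triangle_ineq norm_triangle_mono order_refl)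
  then have "(norm (reg_op K F \<alpha> (y' + z) - x))\<^sup>2 \<le> (p + q + r)\<^sup>2"
    by (rule power_mono) simp
  also have "\<dots> \<le> 3 * p\<^sup>2 + 3 * q\<^sup>2 + 3 * r\<^sup>2"
  proof -
    have "0 \<le> (p - q)\<^sup>2 + (q - r)\<^sup>2 + (p - r)\<^sup>2" by simp
    then show ?thesis by (simp add: power2_eq_square algebra_simps)
  qed
  also have "\<dots> \<le> 3 * p\<^sup>2 + 3 * (a * b * (norm (y - y'))\<^sup>2) + 3 * (a * b * (norm z)\<^sup>2)"
    using bound[of "y' - y"] bound[of z]
    unfolding q_def r_def by (simp add: norm_minus_commute)
  finally show ?thesis by (simp add: p_def algebra_simps)
qed

end

section \<open>The discretisation operators\<close>

lemma Rinner_commute: "Rinner m v w = Rinner m w v"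
  by (simp add: Rinner_def mult.commute)

lemma Rinner_diff_left: "Rinner m (v - w) z = Rinner m v z - Rinner m w z"
  by (simp add: Rinner_def left_diff_distrib sum_subtractf)

lemma Rinner_add_left: "Rinner m (\<lambda>k. v k + w k) z = Rinner m v z + Rinner m w z"
  by (simp add: Rinner_def distrib_right sum.distrib)

lemma Rinner_sum_left: "Rinner m (\<lambda>k. \<Sum>j\<in>I. a j * u j k) z = (\<Sum>j\<in>I. a j * Rinner m (u j) z)"
  unfolding Rinner_def sum_distrib_left sum_distrib_right
  by (subst sum.swap) (simp add: ac_simps)

lemma Rinner_sum_right: "Rinner m z (\<lambda>k. \<Sum>j\<in>I. a j * u j k) = (\<Sum>j\<in>I. a j * Rinner m z (u j))"
  by (subst (1 2) Rinner_commute) (rule Rinner_sum_left)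

text \<open>On all functions \<open>Rinner m\<close> is only positive semidefinite, as it sees just
  the coordinates in \<open>{1..m}\<close>. The usual argument survives: the form is nonnegative at
  w minus its projection p.\<close>

lemma Rinner_bessel:
  assumes orth: "\<And>i j. i \<in> I \<Longrightarrow> j \<in> I \<Longrightarrow> Rinner m (u i) (u j) = (if i = j then 1 else 0)"
    and "finite I"
  shows "(\<Sum>j\<in>I. (Rinner m w (u j))\<^sup>2) \<le> Rinner m w w"
proof -
  define p where "p = (\<lambda>k. \<Sum>j\<in>I. Rinner m w (u j) * u j k)"
  have pu: "Rinner m p (u j) = Rinner m w (u j)" if "j \<in> I" for j
    using that assms(2) by (simp add: p_def Rinner_sum_left orth mult_delta_right)
  have "Rinner m (w - p) p = 0"
    unfolding Rinner_diff_left
    by (subst (1 3) p_def) (simp add: Rinner_sum_right pu)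
  then have "Rinner m (w - p) (w - p) = Rinner m w w - Rinner m p w"
    by (metis Rinner_commute Rinner_diff_left diff_zero)
  moreover have "0 \<le> Rinner m (w - p) (w - p)" by (simp add: Rinner_def sum_nonneg)
  moreover have "Rinner m p w = (\<Sum>j\<in>I. (Rinner m w (u j))\<^sup>2)"
    by (simp add: p_def Rinner_sum_left power2_eq_square Rinner_commute[of m w])
  ultimately show ?thesis by simp
qed

text \<open>In the singular basis the normal equation fixes each coefficient
  \<open>inner x (v j)\<close> separately, and the null space consists of the vectors orthogonal to
  all \<open>v j\<close>. Two candidates therefore differ by a vector lying both in the null space
  and in its orthogonal complement.\<close>

lemma mp_inverse_svd:
  assumes \<sigma>: "\<And>j. j \<in> {1..m} \<Longrightarrow> \<sigma> j > (0::real)"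
    and v: "\<And>i j. i \<in> {1..m} \<Longrightarrow> j \<in> {1..m} \<Longrightarrow> inner (v i) (v j) = (if i = j then 1 else 0)"
    and u: "\<And>i j. i \<in> {1..m} \<Longrightarrow> j \<in> {1..m} \<Longrightarrow> Rinner m (u i) (u j) = (if i = j then 1 else 0)"
    and P: "\<And>y. P y = (\<lambda>k. \<Sum>j=1..m. \<sigma> j * inner y (v j) * u j k)"
  shows "mp_inverse (Rinner m) P w = (\<Sum>j=1..m. (Rinner m w (u j) / \<sigma> j) *\<^sub>R v j)"
proof -
  have Pu: "Rinner m (P y) (u j) = \<sigma> j * inner y (v j)" if "j \<in> {1..m}" for y j
    unfolding P Rinner_sum_left using that u by (simp add: mult_delta_right)
  have P0: "P 0 = (\<lambda>_. 0)" by (simp add: P)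
  have ker: "P z = P 0 \<longleftrightarrow> (\<forall>j\<in>{1..m}. inner z (v j) = 0)" for z
  proof
    assume "P z = P 0"
    then have "\<sigma> j * inner z (v j) = 0" if "j \<in> {1..m}" for j
      using Pu[OF that, of z] Pu[OF that, of 0] by simp
    then show "\<forall>j\<in>{1..m}. inner z (v j) = 0" using \<sigma> by fastforce
  qed (simp add: P)
  have normal: "(\<forall>z. Rinner m (w - P x) (P z) = 0)
      \<longleftrightarrow> (\<forall>j\<in>{1..m}. inner x (v j) = Rinner m w (u j) / \<sigma> j)" for x
  proof -
    have Rz: "Rinner m (w - P x) (P z)
        = (\<Sum>j=1..m. \<sigma> j * inner z (v j) * (Rinner m w (u j) - \<sigma> j * inner x (v j)))" for z
      by (subst P) (simp add: Rinner_sum_right Rinner_diff_left Pu)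
    show ?thesis
    proof
      assume z: "\<forall>z. Rinner m (w - P x) (P z) = 0"
      show "\<forall>j\<in>{1..m}. inner x (v j) = Rinner m w (u j) / \<sigma> j"
      proof
        fix i assume i: "i \<in> {1..m}"
        \<comment> \<open>The test vector z = \<open>v i\<close> isolates the i-th
          coefficient.\<close>
        have "(\<Sum>j=1..m. \<sigma> j * inner (v i) (v j) * (Rinner m w (u j) - \<sigma> j * inner x (v j)))
            = (\<Sum>j=1..m. if i = j then \<sigma> j * (Rinner m w (u j) - \<sigma> j * inner x (v j)) else 0)"
          using i v by (intro sum.cong) auto
        also have "\<dots> = \<sigma> i * (Rinner m w (u i) - \<sigma> i * inner x (v i))" using i by simp
        finally have "\<sigma> i * (Rinner m w (u i) - \<sigma> i * inner x (v i)) = 0" using z Rz[of "v i"] by simp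
        then show "inner x (v i) = Rinner m w (u i) / \<sigma> i" using \<sigma>[OF i] by (simp add: field_simps)
      qed
    next
      assume j: "\<forall>j\<in>{1..m}. inner x (v j) = Rinner m w (u j) / \<sigma> j"
      have "\<sigma> j * inner z (v j) * (Rinner m w (u j) - \<sigma> j * inner x (v j)) = 0"
        if "j \<in> {1..m}" for j z
        using j that \<sigma>[OF that] by simp
      then show "\<forall>z. Rinner m (w - P x) (P z) = 0" unfolding Rz by (intro allI sum.neutral) blast
    qed
  qed
  define x where "x = (\<Sum>j=1..m. (Rinner m w (u j) / \<sigma> j) *\<^sub>R v j)"
  have xv: "inner x (v i) = Rinner m w (u i) / \<sigma> i" if "i \<in> {1..m}" for i
  proof -
    have "inner x (v i) = (\<Sum>j=1..m. if j = i then Rinner m w (u j) / \<sigma> j else 0)"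
      unfolding x_def inner_sum_left using that v by (intro sum.cong) auto
    then show ?thesis using that by simp
  qed
  have "x \<in> orthogonal_comp {z. P z = P 0}"
    unfolding orthogonal_comp_def orthogonal_def ker by (auto simp: x_def inner_sum_right)
  moreover have "x' = x" if x': "x' \<in> orthogonal_comp {z. P z = P 0}"
    "\<forall>z. Rinner m (w - P x') (P z) = 0" for x'
  proof -
    have "x' - x \<in> orthogonal_comp {z. P z = P 0}"
      using x'(1) \<open>x \<in> _\<close> by (simp add: subspace_diff[OF subspace_orthogonal_comp])
    moreover have "P (x' - x) = P 0"
      using x'(2) xv unfolding ker normal by (simp add: inner_diff_left)
    ultimately have "inner (x' - x) (x' - x) = 0"
      by (simp add: orthogonal_comp_def orthogonal_def)
    then show ?thesis unfolding inner_eq_zero_iff by simp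
  qed
  moreover have "\<forall>z. Rinner m (w - P x) (P z) = 0" using xv normal by blast
  ultimately show ?thesis unfolding mp_inverse_def x_def[symmetric]
    by (intro the_equality conjI) blast+
qed

text \<open>Both facts are read off from the explicit singular value formula, which hides the choice
  of the singular vectors; the bound uses that each coefficient is divided by at least c.\<close>

lemma mp_inverse_singular_values:
  assumes "are_singular_values m P \<sigma>"
  shows mp_inverse_add: "mp_inverse (Rinner m) P (\<lambda>k. w k + w' k)
      = mp_inverse (Rinner m) P w + mp_inverse (Rinner m) P w'"
    and mp_inverse_norm_le: "\<lbrakk>0 < c; \<And>j. j \<in> {1..m} \<Longrightarrow> c \<le> \<sigma> j\<rbrakk> \<Longrightarrow>
      (norm (mp_inverse (Rinner m) P w))\<^sup>2 \<le> Rinner m w w / c\<^sup>2"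
proof -
  from assms obtain v u where \<sigma>: "\<And>j. j \<in> {1..m} \<Longrightarrow> \<sigma> j > 0"
    and v: "\<And>i j. i \<in> {1..m} \<Longrightarrow> j \<in> {1..m} \<Longrightarrow> inner (v i) (v j) = (if i = j then 1 else 0)"
    and u: "\<And>i j. i \<in> {1..m} \<Longrightarrow> j \<in> {1..m} \<Longrightarrow> Rinner m (u i) (u j) = (if i = j then 1 else 0)"
    and P: "\<And>y. P y = (\<lambda>k. \<Sum>j=1..m. \<sigma> j * inner y (v j) * u j k)"
    unfolding are_singular_values_def by blast
  have svd: "mp_inverse (Rinner m) P w = (\<Sum>j=1..m. (Rinner m w (u j) / \<sigma> j) *\<^sub>R v j)" for w
    by (rule mp_inverse_svd; fact)
  show "mp_inverse (Rinner m) P (\<lambda>k. w k + w' k)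
      = mp_inverse (Rinner m) P w + mp_inverse (Rinner m) P w'"
    by (simp add: svd Rinner_add_left add_divide_distrib scaleR_add_left sum.distrib)
  assume c: "0 < c" "\<And>j. j \<in> {1..m} \<Longrightarrow> c \<le> \<sigma> j"
  have nv: "(norm (v j))\<^sup>2 = 1" if "j \<in> {1..m}" for j
    using v[OF that that] by (simp add: power2_norm_eq_inner)
  have "(norm (mp_inverse (Rinner m) P w))\<^sup>2 = (\<Sum>j=1..m. (norm ((Rinner m w (u j) / \<sigma> j) *\<^sub>R v j))\<^sup>2)"
    unfolding svd using v by (intro norm_sum_Pythagorean) (auto simp: pairwise_def orthogonal_def)
  also have "\<dots> = (\<Sum>j=1..m. (Rinner m w (u j))\<^sup>2 / (\<sigma> j)\<^sup>2)"
    by (intro sum.cong) (simp_all add: power_mult_distrib nv power_divide)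
  also have "\<dots> \<le> (\<Sum>j=1..m. (Rinner m w (u j))\<^sup>2 / c\<^sup>2)"
  proof (rule sum_mono)
    fix j assume "j \<in> {1..m}"
    then show "(Rinner m w (u j))\<^sup>2 / (\<sigma> j)\<^sup>2 \<le> (Rinner m w (u j))\<^sup>2 / c\<^sup>2"
      using c(1) c(2)[of j] by (intro divide_left_mono power_mono mult_pos_pos zero_less_power) auto
  qed
  also have "\<dots> = (\<Sum>j=1..m. (Rinner m w (u j))\<^sup>2) / c\<^sup>2" by (simp add: sum_divide_distrib)
  also have "\<dots> \<le> Rinner m w w / c\<^sup>2"
    using Rinner_bessel[of "{1..m}" m u, OF u] by (intro divide_right_mono) auto
  finally show "(norm (mp_inverse (Rinner m) P w))\<^sup>2 \<le> Rinner m w w / c\<^sup>2" .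
qed

section \<open>The averaged noise\<close>

text \<open>Independence and zero mean kill the mixed products in the expanded square, so N second
  moments remain against a denominator N^2, where N is \<open>card I\<close>.\<close>

lemma (in prob_space) mean_square_average_le:
  fixes X :: "'i \<Rightarrow> 'a \<Rightarrow> real"
  assumes ind: "indep_vars (\<lambda>_. borel) X I" and I: "finite I"
    and int: "\<And>i. i \<in> I \<Longrightarrow> integrable M (X i)" and mean: "\<And>i. i \<in> I \<Longrightarrow> expectation (X i) = 0"
    and int2: "\<And>i. i \<in> I \<Longrightarrow> integrable M (\<lambda>\<omega>. (X i \<omega>)\<^sup>2)"
    and var: "\<And>i. i \<in> I \<Longrightarrow> expectation (\<lambda>\<omega>. (X i \<omega>)\<^sup>2) \<le> C"
  shows "integrable M (\<lambda>\<omega>. ((\<Sum>i\<in>I. X i \<omega>) / card I)\<^sup>2)" (is ?int)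
    and "expectation (\<lambda>\<omega>. ((\<Sum>i\<in>I. X i \<omega>) / card I)\<^sup>2) \<le> C / card I" (is ?le)
proof -
  have prod: "integrable M (\<lambda>\<omega>. X i \<omega> * X j \<omega>) \<and>
      expectation (\<lambda>\<omega>. X i \<omega> * X j \<omega>) = (if i = j then expectation (\<lambda>\<omega>. (X i \<omega>)\<^sup>2) else 0)"
    if "i \<in> I" "j \<in> I" for i j
  proof (cases "i = j")
    case False
    have "indep_vars (\<lambda>_. borel) X {i, j}" using indep_vars_subset[OF ind] that by simp
    moreover have "integrable M (X k)" if "k \<in> {i, j}" for k
      using that \<open>i \<in> I\<close> \<open>j \<in> I\<close> int by auto
    ultimately have "expectation (\<lambda>\<omega>. \<Prod>k\<in>{i, j}. X k \<omega>) = (\<Prod>k\<in>{i, j}. expectation (X k))"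
      "integrable M (\<lambda>\<omega>. \<Prod>k\<in>{i, j}. X k \<omega>)"
      by (intro indep_vars_lebesgue_integral indep_vars_integrable; simp)+
    then
    show ?thesis using False that mean by simp
  qed (use int2[OF that(1)] in \<open>simp add: power2_eq_square\<close>)
  have sq: "(\<Sum>i\<in>I. X i \<omega>)\<^sup>2 = (\<Sum>i\<in>I. \<Sum>j\<in>I. X i \<omega> * X j \<omega>)" for \<omega>
    by (simp add: power2_eq_square sum_product)
  have intS: "integrable M (\<lambda>\<omega>. (\<Sum>i\<in>I. X i \<omega>)\<^sup>2)"
    unfolding sq using prod by (intro Bochner_Integration.integrable_sum) auto
  then show ?int by (simp add: power_divide)
  have "expectation (\<lambda>\<omega>. (\<Sum>i\<in>I. X i \<omega>)\<^sup>2) = (\<Sum>i\<in>I. \<Sum>j\<in>I. expectation (\<lambda>\<omega>. X i \<omega> * X j \<omega>))"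
    unfolding sq using prod by (simp add: Bochner_Integration.integral_sum Bochner_Integration.integrable_sum)
  also have "\<dots> = (\<Sum>i\<in>I. expectation (\<lambda>\<omega>. (X i \<omega>)\<^sup>2))"
    using prod I by simp
  also have "\<dots> \<le> card I * C" using var by (rule sum_bounded_above)
  finally have "expectation (\<lambda>\<omega>. (\<Sum>i\<in>I. X i \<omega>)\<^sup>2) / (real (card I))\<^sup>2 \<le> card I * C / (real (card I))\<^sup>2"
    by (rule divide_right_mono) simp
  \<comment> \<open>For empty I both sides are quotients by 0 and hence 0.\<close>
  then show ?le by (cases "card I = 0") (simp_all add: power_divide power2_eq_square)
qed

section \<open>Combination of bias, discretisation error and noise\<close>

theorem theorem3p8:
  fixes K :: "'a::{real_inner, complete_space} \<Rightarrow> 'b::{real_inner, complete_space}"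
    and l :: "nat \<Rightarrow> nat \<Rightarrow> 'b \<Rightarrow> real"
    and \<sigma> :: "nat \<Rightarrow> nat \<Rightarrow> real"
    and yhat :: 'b
    and \<delta>disc c C :: "nat \<Rightarrow> real"
    and M :: "'w measure"
    and \<delta> :: "nat \<Rightarrow> nat \<Rightarrow> nat \<Rightarrow> 'w \<Rightarrow> real"
    and C\<^sub>d :: real
    and F :: "real \<Rightarrow> real \<Rightarrow> real"
    and \<nu>\<^sub>0 :: ennreal
    and \<alpha> :: "real \<Rightarrow> real"
  defines "P \<equiv> \<lambda>m. sample_op m (l m)"
  defines "Pinv \<equiv> \<lambda>m. mp_inverse (Rinner m) (P m)"
  defines "n \<equiv> \<lambda>m. nat \<lceil>real m / ((c m)\<^sup>2 * (\<delta>disc m)\<^sup>2)\<rceil>"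
  assumes inf_dim: "\<not> (\<exists>B::'a set. finite B \<and> span B = UNIV)"
                   "\<not> (\<exists>B::'b set. finite B \<and> span B = UNIV)"
    and K: "compact_operator K" "inj K"
    and l: "\<And>m j. j \<in> {1..m} \<Longrightarrow> bounded_linear (l m j)"
           "\<And>m i j. i \<in> {1..m} \<Longrightarrow> j \<in> {1..m} \<Longrightarrow> onorm (l m i) = onorm (l m j)"
    and P_bij: "\<And>m. bij_betw (P m \<circ> Radjoint m (P m)) (Rvec m) (Rvec m)"
    and \<sigma>: "\<And>m. are_singular_values m (P m) (\<sigma> m)"
    and yhat: "yhat \<in> mp_domain K"
    and pos: "\<And>m. m \<ge> 1 \<Longrightarrow> \<delta>disc m > 0 \<and> c m > 0 \<and> C m > 0"
    and disc: "eventually (\<lambda>m. norm (yhat - Pinv m (P m yhat)) \<le> \<delta>disc m) sequentially"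
    and sv_bounds: "eventually (\<lambda>m. \<forall>j\<in>{1..m}. 0 < c m \<and> c m \<le> \<sigma> m j \<and> \<sigma> m j \<le> C m) sequentially"
    and \<delta>disc_lim: "\<delta>disc \<longlonglongrightarrow> 0"
    and cond: "limsup (\<lambda>m. ereal (C m / c m)) < \<infinity>"
    and M: "prob_space M"
    and indep: "\<And>m j. j \<in> {1..m} \<Longrightarrow> prob_space.indep_vars M (\<lambda>_. borel) (\<lambda>i. \<delta> m i j) {1..}"
    and mean: "\<And>m i j. i \<ge> 1 \<Longrightarrow> j \<in> {1..m} \<Longrightarrow>
                 integrable M (\<delta> m i j) \<and> (\<integral>\<omega>. \<delta> m i j \<omega> \<partial>M) = 0"
    and variance: "\<And>m i j. i \<ge> 1 \<Longrightarrow> j \<in> {1..m} \<Longrightarrow>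
                 integrable M (\<lambda>\<omega>. (\<delta> m i j \<omega>)\<^sup>2) \<and> (\<integral>\<omega>. (\<delta> m i j \<omega>)\<^sup>2 \<partial>M) \<le> C\<^sub>d"
    and F: "regularising_filter ((onorm K)\<^sup>2) F \<nu>\<^sub>0"
    and \<alpha>: "\<And>t. t > 0 \<Longrightarrow> \<alpha> t > 0"
           "(\<alpha> \<longlongrightarrow> 0) (at_right 0)"
           "((\<lambda>t. t / sqrt (\<alpha> t)) \<longlongrightarrow> 0) (at_right 0)"
  shows "(\<lambda>m. \<integral>\<^sup>+\<omega>. ennreal ((norm (reg_op K F (\<alpha> (\<delta>disc m))
                   (Pinv m (mean_meas m (l m) yhat (\<delta> m) (n m) \<omega>)) - mp_inverse inner K yhat))\<^sup>2) \<partial>M)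
         \<longlonglongrightarrow> 0"
proof -
  interpret K: compact_injective_operator K using K by unfold_locales
  interpret M: prob_space M by fact
  define x where "x = mp_inverse inner K yhat"
  have x: "adjoint K yhat = (adjoint K \<circ> K) x"
    unfolding x_def by (rule K.mp_inverse_normal_equation[OF yhat])
  obtain C1 C2 where C12: "\<forall>\<alpha>>0. \<forall>\<mu>\<in>{0<..(onorm K)\<^sup>2}. \<mu> * \<bar>F \<alpha> \<mu>\<bar> \<le> C1"
    "\<forall>\<alpha>>0. \<forall>\<mu>\<in>{0<..(onorm K)\<^sup>2}. \<bar>F \<alpha> \<mu>\<bar> \<le> C2 / \<alpha>"
    using F unfolding regularising_filter_def by blast
  \<comment> \<open>The filter conditions supply real constants of unspecified sign; raising them to
    at least 0 keeps the bounds and permits multiplication of inequalities.\<close>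
  define CR CF where "CR = max C1 0" and "CF = max C2 0"
  have nn: "0 \<le> CR" "0 \<le> CF" by (simp_all add: CR_def CF_def)
  have CR: "\<mu> * \<bar>F a \<mu>\<bar> \<le> CR" and CF: "\<bar>F a \<mu>\<bar> \<le> CF / a"
    if "a > 0" "\<mu> \<in> {0<..(onorm K)\<^sup>2}" for a \<mu>
  proof -
    have "\<mu> * \<bar>F a \<mu>\<bar> \<le> C1" "\<bar>F a \<mu>\<bar> \<le> C2 / a" using C12 that by blast+
    moreover have "C2 / a \<le> CF / a" using that(1) by (intro divide_right_mono) (simp_all add: CF_def)
    ultimately show "\<mu> * \<bar>F a \<mu>\<bar> \<le> CR" "\<bar>F a \<mu>\<bar> \<le> CF / a" by (auto simp: CR_def)
  qed
  have "0 \<le> M.expectation (\<lambda>\<omega>. (\<delta> 1 1 1 \<omega>)\<^sup>2)" by (intro integral_nonneg_AE) simp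
  also have "\<dots> \<le> C\<^sub>d" using variance[of 1 1 1] by simp
  finally have Cd: "0 \<le> C\<^sub>d" .
  define bias where "bias a = (norm (reg_op K F a yhat - x))\<^sup>2" for a
  have "((\<lambda>a. reg_op K F a yhat) \<longlongrightarrow> x) (at_right 0)"
    by (rule K.reg_op_converges[OF nn(1) CR regularising_filter_pointwise[OF F] x])
  from tendsto_power[OF tendsto_norm[OF LIM_zero[OF this]], of 2]
  have bias_lim: "(bias \<longlongrightarrow> 0) (at_right 0)" by (simp add: bias_def[abs_def])
  \<comment> \<open>Positivity matters here: the limits in \<alpha> and in \<delta> are one-sided at
    0, so composing them requires approach from the right.\<close>
  have \<delta>_lim: "filterlim \<delta>disc (at_right 0) sequentially"
  proof -
    have "\<forall>\<^sub>F m in sequentially. \<delta>disc m \<in> {0<..} \<and> \<delta>disc m \<noteq> 0"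
      using eventually_ge_at_top[of 1] by eventually_elim (use pos in force)
    then show ?thesis using \<delta>disc_lim by (simp add: filterlim_at)
  qed
  have \<alpha>_lim: "filterlim \<alpha> (at_right 0) (at_right 0)"
  proof -
    have "\<forall>\<^sub>F t in at_right 0. \<alpha> t \<in> {0<..} \<and> \<alpha> t \<noteq> 0"
      using eventually_at_right_less[of 0] by eventually_elim (use \<alpha>(1) in force)
    then show ?thesis using \<alpha>(2) by (simp add: filterlim_at)
  qed
  \<comment> \<open>In the factor 1 + \<open>C\<^sub>d\<close> the 1 accounts for the discretisation
    error and \<open>C\<^sub>d\<close> for the noise.\<close>
  define bnd where "bnd m = 3 * bias (\<alpha> (\<delta>disc m))
      + 3 * (CR * CF) * (1 + C\<^sub>d) * (\<delta>disc m / sqrt (\<alpha> (\<delta>disc m)))\<^sup>2" for m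
  have "(\<lambda>m. bias (\<alpha> (\<delta>disc m))) \<longlonglongrightarrow> 0"
    by (intro filterlim_compose[OF bias_lim] filterlim_compose[OF \<alpha>_lim] \<delta>_lim)
  moreover have "(\<lambda>m. \<delta>disc m / sqrt (\<alpha> (\<delta>disc m))) \<longlonglongrightarrow> 0"
    by (rule filterlim_compose[OF \<alpha>(3) \<delta>_lim])
  ultimately have "bnd \<longlonglongrightarrow> 3 * 0 + 3 * (CR * CF) * (1 + C\<^sub>d) * 0\<^sup>2"
    unfolding bnd_def by (intro tendsto_intros)
  then have bnd_lim: "(\<lambda>m. ennreal (bnd m)) \<longlonglongrightarrow> 0"
    using tendsto_ennrealI[of bnd 0] by simp
  have step: "(\<integral>\<^sup>+\<omega>. ennreal ((norm (reg_op K F (\<alpha> (\<delta>disc m))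
      (Pinv m (mean_meas m (l m) yhat (\<delta> m) (n m) \<omega>)) - x))\<^sup>2) \<partial>M) \<le> ennreal (bnd m)"
    if m: "m \<ge> 1" and disc_m: "norm (yhat - Pinv m (P m yhat)) \<le> \<delta>disc m"
      and sv_m: "\<forall>j\<in>{1..m}. 0 < c m \<and> c m \<le> \<sigma> m j \<and> \<sigma> m j \<le> C m" for m
  proof -
    define a where "a = \<alpha> (\<delta>disc m)"
    have \<delta>0: "\<delta>disc m > 0" and c0: "c m > 0" using pos[OF m] by auto
    have a0: "a > 0" unfolding a_def by (rule \<alpha>(1)[OF \<delta>0])
    have "real m / ((c m)\<^sup>2 * (\<delta>disc m)\<^sup>2) > 0" using m \<delta>0 c0 by simp
    then have nm: "real m / ((c m)\<^sup>2 * (\<delta>disc m)\<^sup>2) \<le> real (n m)" "n m > 0"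
      unfolding n_def by (auto simp: real_nat_ceiling_ge)
    define W where "W \<omega> = (\<lambda>j. if j \<in> {1..m} then (\<Sum>i=1..n m. \<delta> m i j \<omega>) / real (n m) else 0)" for \<omega>
    \<comment> \<open>Averaging the constant \<open>l m j yhat\<close> returns it because
      \<open>n m\<close> is positive; over no measurements the mean would be 0.\<close>
    have meas: "mean_meas m (l m) yhat (\<delta> m) (n m) \<omega> = (\<lambda>k. P m yhat k + W \<omega> k)" for \<omega>
      using nm(2) by (auto simp: fun_eq_iff mean_meas_def P_def sample_op_def W_def sum.distrib add_divide_distrib)
    have pw: "(norm (reg_op K F a (Pinv m (mean_meas m (l m) yhat (\<delta> m) (n m) \<omega>)) - x))\<^sup>2
        \<le> (3 * bias a + 3 * (CR * (CF / a)) * (\<delta>disc m)\<^sup>2) + 3 * (CR * (CF / a)) / (c m)\<^sup>2 * (\<Sum>j=1..m. (W \<omega> j)\<^sup>2)"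
      for \<omega>
    proof -
      have "(norm (Pinv m (W \<omega>)))\<^sup>2 \<le> Rinner m (W \<omega>) (W \<omega>) / (c m)\<^sup>2"
        unfolding Pinv_def using sv_m by (intro mp_inverse_norm_le[OF \<sigma> c0]) auto
      also have "Rinner m (W \<omega>) (W \<omega>) = (\<Sum>j=1..m. (W \<omega> j)\<^sup>2)"
        by (simp add: Rinner_def power2_eq_square)
      finally have W_le: "(norm (Pinv m (W \<omega>)))\<^sup>2 \<le> (\<Sum>j=1..m. (W \<omega> j)\<^sup>2) / (c m)\<^sup>2" .
      have d_le: "(norm (yhat - Pinv m (P m yhat)))\<^sup>2 \<le> (\<delta>disc m)\<^sup>2"
        using disc_m by (rule power_mono) simp
      have "Pinv m (mean_meas m (l m) yhat (\<delta> m) (n m) \<omega>) = Pinv m (P m yhat) + Pinv m (W \<omega>)"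
        unfolding meas Pinv_def by (rule mp_inverse_add[OF \<sigma>])
      then have "(norm (reg_op K F a (Pinv m (mean_meas m (l m) yhat (\<delta> m) (n m) \<omega>)) - x))\<^sup>2
          \<le> 3 * bias a + 3 * (CR * (CF / a)) * ((norm (yhat - Pinv m (P m yhat)))\<^sup>2 + (norm (Pinv m (W \<omega>)))\<^sup>2)"
        unfolding bias_def using nn a0 CR[OF a0] CF[OF a0]
        by (simp only:) (rule K.reg_op_perturbation_bound; simp)
      also have "\<dots> \<le> 3 * bias a + 3 * (CR * (CF / a)) * ((\<delta>disc m)\<^sup>2 + (\<Sum>j=1..m. (W \<omega> j)\<^sup>2) / (c m)\<^sup>2)"
        using nn a0 by (intro add_left_mono mult_left_mono add_mono W_le d_le) auto
      finally show ?thesis by (simp add: algebra_simps)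
    qed
    have Wj: "integrable M (\<lambda>\<omega>. (W \<omega> j)\<^sup>2)" "M.expectation (\<lambda>\<omega>. (W \<omega> j)\<^sup>2) \<le> C\<^sub>d / n m"
      if j: "j \<in> {1..m}" for j
    proof -
      have "M.indep_vars (\<lambda>_. borel) (\<lambda>i. \<delta> m i j) {1..n m}"
        by (rule M.indep_vars_subset[OF indep[OF j]]) auto
      from M.mean_square_average_le[OF this, of C\<^sub>d] mean[OF _ j] variance[OF _ j]
      show "integrable M (\<lambda>\<omega>. (W \<omega> j)\<^sup>2)" "M.expectation (\<lambda>\<omega>. (W \<omega> j)\<^sup>2) \<le> C\<^sub>d / n m"
        using j by (simp_all add: W_def)
    qed
    define k where "k = 3 * (CR * (CF / a)) / (c m)\<^sup>2"
    have k0: "k \<ge> 0" using nn a0 by (simp add: k_def)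
    have intS: "integrable M (\<lambda>\<omega>. \<Sum>j=1..m. (W \<omega> j)\<^sup>2)"
      by (intro Bochner_Integration.integrable_sum Wj(1))
    \<comment> \<open>Integrability of the majorant turns its nonnegative integral into an
      expectation. The error enters by monotonicity of the nonnegative integral alone, which asks
      nothing about its measurability.\<close>
    have int: "integrable M (\<lambda>\<omega>. (3 * bias a + 3 * (CR * (CF / a)) * (\<delta>disc m)\<^sup>2) + k * (\<Sum>j=1..m. (W \<omega> j)\<^sup>2))"
      by (intro Bochner_Integration.integrable_add integrable_mult_right
          intS M.integrable_const)
    have "(\<integral>\<^sup>+\<omega>. ennreal ((norm (reg_op K F a
        (Pinv m (mean_meas m (l m) yhat (\<delta> m) (n m) \<omega>)) - x))\<^sup>2) \<partial>M)
      \<le> (\<integral>\<^sup>+\<omega>. ennreal ((3 * bias a + 3 * (CR * (CF / a)) * (\<delta>disc m)\<^sup>2) + k * (\<Sum>j=1..m. (W \<omega> j)\<^sup>2)) \<partial>M)"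
      unfolding k_def by (intro nn_integral_mono ennreal_leI pw)
    also have "\<dots> = ennreal (M.expectation (\<lambda>\<omega>. (3 * bias a + 3 * (CR * (CF / a)) * (\<delta>disc m)\<^sup>2) + k * (\<Sum>j=1..m. (W \<omega> j)\<^sup>2)))"
      using nn a0 k0 by (intro nn_integral_eq_integral[OF int] always_eventually allI)
        (auto simp: bias_def intro!: add_nonneg_nonneg mult_nonneg_nonneg sum_nonneg)
    also have "M.expectation (\<lambda>\<omega>. (3 * bias a + 3 * (CR * (CF / a)) * (\<delta>disc m)\<^sup>2) + k * (\<Sum>j=1..m. (W \<omega> j)\<^sup>2))
        = (3 * bias a + 3 * (CR * (CF / a)) * (\<delta>disc m)\<^sup>2) + k * (\<Sum>j=1..m. M.expectation (\<lambda>\<omega>. (W \<omega> j)\<^sup>2))"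
      by (subst Bochner_Integration.integral_add)
        (simp_all add: M.prob_space Wj(1) intS Bochner_Integration.integral_sum del: One_nat_def)
    also have "\<dots> \<le> (3 * bias a + 3 * (CR * (CF / a)) * (\<delta>disc m)\<^sup>2) + k * (real m * (C\<^sub>d / n m))"
      using k0 sum_bounded_above[of "{1..m}" "\<lambda>j. M.expectation (\<lambda>\<omega>. (W \<omega> j)\<^sup>2)" "C\<^sub>d / n m", OF Wj(2)]
      by (intro add_left_mono mult_left_mono) auto
    \<comment> \<open>This is where the number of measurements is tuned: rounding up gives m / (n
      c^2) \<le> \<delta>^2, so the noise is no larger in order than the discretisation
      error.\<close>
    also have "k * (real m * (C\<^sub>d / n m)) \<le> 3 * (CR * (CF / a)) * (C\<^sub>d * (\<delta>disc m)\<^sup>2)"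
    proof -
      have "real m \<le> real (n m) * ((c m)\<^sup>2 * (\<delta>disc m)\<^sup>2)"
        using nm(1) c0 \<delta>0 by (simp add: divide_le_eq)
      then have "real m / (real (n m) * (c m)\<^sup>2) \<le> (\<delta>disc m)\<^sup>2"
        using nm(2) c0 by (simp add: divide_le_eq ac_simps)
      then have "3 * (CR * (CF / a)) * C\<^sub>d * (real m / (real (n m) * (c m)\<^sup>2)) \<le> 3 * (CR * (CF / a)) * C\<^sub>d * (\<delta>disc m)\<^sup>2"
        using nn a0 Cd by (intro mult_left_mono) auto
      then show ?thesis by (simp add: k_def field_simps)
    qed
    also have "(3 * bias a + 3 * (CR * (CF / a)) * (\<delta>disc m)\<^sup>2) + 3 * (CR * (CF / a)) * (C\<^sub>d * (\<delta>disc m)\<^sup>2) = bnd m"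
      using a0 by (simp add: bnd_def a_def[symmetric] power_divide field_simps)
    finally show ?thesis by (simp add: a_def ennreal_leI)
  qed
  show ?thesis
  proof (rule tendsto_sandwich[OF _ _ tendsto_const bnd_lim])
    show "\<forall>\<^sub>F m in sequentially. (\<integral>\<^sup>+\<omega>. ennreal ((norm (reg_op K F (\<alpha> (\<delta>disc m))
        (Pinv m (mean_meas m (l m) yhat (\<delta> m) (n m) \<omega>)) - mp_inverse inner K yhat))\<^sup>2) \<partial>M) \<le> ennreal (bnd m)"
      using disc sv_bounds eventually_ge_at_top[of 1]
      by eventually_elim (use step in \<open>simp add: x_def\<close>)
  qed auto
qed

end
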